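(* Let $1 \leq p \leq \infty$. For every $p$-finite countable barcode $B \in \overline{D}_p^{\triangle}(\widehat{\mathrm{Int}}(\mathbb{R})_{bco})$, the persistence landscape $\Lambda_B$ belongs to $L^p(\mathbb{N} \times \mathbb{R})$, and the map $$\Lambda: \left(\overline{D}_p^{\triangle}(\widehat{\mathrm{Int}}(\mathbb{R})_{bco}),\, W_p^{\triangle}\right) \to L^p(\mathbb{N} \times \mathbb{R}), \qquad B \mapsto \Lambda_B,$$ is a $1$-Lipschitz embedding; that is, $\Lambda$ is injective and $\|\Lambda_B - \Lambda_{B'}\|_p \leq W_p^{\triangle}(B,B')$ for all $B, B'$ in its domain.
   Context: Intervals. $\widehat{\mathrm{Int}}(\mathbb{R})_{bco}$ is the set of intervals $[b,d) \subseteq \mathbb{R}$ with $-\infty < b < d < \infty$; $\mathrm{Int}(\mathbb{R})_{bco}$ is this set together with the empty interval $\emptyset$, which is its basepoint. The triangle function of $I \in \mathrm{Int}(\mathbb{R})_{bco}$ is $\triangle_I : \mathbb{R} \to [0,\infty)$, where $\triangle_I(t) = \inf_{a \in \mathbb{R}\setminus I} |t-a|$; in particular $\triangle_\emptyset = 0$. Put $d_p(I,J) = \|\triangle_I - \triangle_J\|_p$, the $L^p$ norm for Lebesgue measure on $\mathbb{R}$. Barcodes. A countable barcode here is a countable (finite or countably infinite) formal sum (multiset) $\sum_i I_i$ of elements of $\widehat{\mathrm{Int}}(\mathbb{R})_{bco}$; the empty sum is $0$. Finite ones are always $p$-finite. An infinite one $\sum_{i=1}^\infty I_i$ is $p$-finite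 if $\|(d_p(I_i,\emptyset))_{i}\|_p < \infty$ when $p<\infty$, and if $\lim_{i\to\infty} d_\infty(I_i,\emptyset) = 0$ when $p = \infty$. $\overline{D}_p^{\triangle}(\widehat{\mathrm{Int}}(\mathbb{R})_{bco})$ is the set of $p$-finite countable barcodes. Wasserstein distance. For finite sums, $$W_p^{\triangle}\Big(\sum_{i=1}^m I_i, \sum_{i=1}^n J_i\Big) = \min_{\sigma \in \Sigma_{m+n}} \left\| (d_p(I_i,J_{\sigma(i)}))_{i=1}^{m+n} \right\|_p,$$ where $I_{m+1}=\cdots=I_{m+n}=\emptyset=J_{n+1}=\cdots=J_{n+m}$ and $\Sigma_{m+n}$ is the symmetric group on $\{1,\dots,m+n\}$. For $p$-finite countable sums, $$W_p^{\triangle}\Big(\sum_{i=1}^\infty I_i,\sum_{i=1}^\infty J_i\Big) = \lim_{n\to\infty} W_p^{\triangle}\Big(\sum_{i=1}^n I_i,\sum_{i=1}^n J_i\Big),$$ where finite sums are regarded as infinite ones by appending copies of $\emptyset$. This is a (complete) metric on $\overline{D}_p^{\triangle}(\widehat{\mathrm{Int}}(\mathbb{R})_{bco})$. Persistence landscape. For $B = \sum_j I_j$, $\Lambda_B(k,t) = \mathrm{kmax}\,(\triangle_{I_j}(t))_j$ for $k \in \mathbb{N} = \{1,2,\dots\}$, $t\in\mathbb{R}$, where $\mathrm{kmax}\, a$ denotes the $k$th largest element, counted with multiplicity, of a sequence $a$ of nonnegative numbers. For a finite sequence with $n$ terms, $\mathrm{kmax}\, a = 0$ for $k>n$. For an infinite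 sequence $a$, let $L = \limsup a$ and let $b$ be the subsequence of terms larger than $L$: if $b$ has $N<\infty$ terms then $\mathrm{kmax}\, a = \mathrm{kmax}\, b$ for $k \leq N$ and $\mathrm{kmax}\, a = L$ for $k>N$; if $b$ is infinite, $a$ has a $k$th largest element for every $k$. (For $p$-finite barcodes, $L=0$ for every $t$.) $\mathbb{N}\times\mathbb{R}$ carries the product of counting measure and Lebesgue measure. *)

theory Defs
  imports
    "HOL-Analysis.Analysis"
    "HOL-Probability.Essential_Supremum"
    "HOL-Library.Extended_Nat"
    "HOL-Combinatorics.Permutations"
begin

section \<open>\<open>L\<^sup>p\<close> norms and \<open>L\<^sup>p\<close> spaces\<close>

text \<open>The exponent \<open>p\<close> ranges over \<open>[1, \<infinity>]\<close>, as an element of \<open>ennreal\<close>.  Norms are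
  \<open>[0, \<infinity>]\<close>-valued, so that they make sense without any integrability hypothesis.\<close>

definition ennpowr :: "ennreal \<Rightarrow> real \<Rightarrow> ennreal" where
  "ennpowr x r = (if x = \<infinity> then \<infinity> else ennreal (enn2real x powr r))"

text \<open>With a counting measure, this is also the \<open>\<ell>\<^sup>p\<close> norm of a finite or infinite sequence;
  for \<open>p = \<infinity>\<close> the essential supremum is then the supremum.\<close>

definition Lp_norm :: "ennreal \<Rightarrow> 'a measure \<Rightarrow> ('a \<Rightarrow> ennreal) \<Rightarrow> ennreal" where
  "Lp_norm p M f =
     (if p = \<infinity> then esssup M f
      else ennpowr (\<integral>\<^sup>+ x. ennpowr (f x) (enn2real p) \<partial>M) (1 / enn2real p))"

definition Lp_functions :: "ennreal \<Rightarrow> 'a measure \<Rightarrow> ('a \<Rightarrow> real) set" where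
  "Lp_functions p M = {f \<in> borel_measurable M. Lp_norm p M (\<lambda>x. ennreal \<bar>f x\<bar>) < \<infinity>}"

definition Lp_rel :: "ennreal \<Rightarrow> 'a measure \<Rightarrow> (('a \<Rightarrow> real) \<times> ('a \<Rightarrow> real)) set" where
  "Lp_rel p M = {(f, g). f \<in> Lp_functions p M \<and> g \<in> Lp_functions p M \<and> (AE x in M. f x = g x)}"

definition Lp_space :: "ennreal \<Rightarrow> 'a measure \<Rightarrow> ('a \<Rightarrow> real) set set" where
  "Lp_space p M = Lp_functions p M // Lp_rel p M"

definition Lp_class :: "ennreal \<Rightarrow> 'a measure \<Rightarrow> ('a \<Rightarrow> real) \<Rightarrow> ('a \<Rightarrow> real) set" where
  "Lp_class p M f = Lp_rel p M `` {f}"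

section \<open>Intervals\<close>

definition Int_hat_bco :: "real set set" where
  "Int_hat_bco = {{b..<d} | b d. b < d}"

definition Int_bco :: "real set set" where
  "Int_bco = insert {} Int_hat_bco"

definition triangle :: "real set \<Rightarrow> real \<Rightarrow> real" where
  "triangle I t = (INF a\<in>UNIV - I. \<bar>t - a\<bar>)"

definition bar_dist :: "ennreal \<Rightarrow> real set \<Rightarrow> real set \<Rightarrow> ennreal" where
  "bar_dist p I J = Lp_norm p lborel (\<lambda>t. ennreal \<bar>triangle I t - triangle J t\<bar>)"

section \<open>Countable barcodes\<close>

text \<open>A countable formal sum of intervals is given by its multiplicity function.\<close>

definition countable_barcodes :: "(real set \<Rightarrow> enat) set" where
  "countable_barcodes =
     {B. {I. B I \<noteq> 0} \<subseteq> Int_hat_bco \<and> countable {I. B I \<noteq> 0}}"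

text \<open>A listing \<open>I 0, I 1, \<dots>\<close> of the summands of \<open>B\<close>, where a finite sum is continued by copies
  of the empty interval.\<close>

definition enumerates :: "(nat \<Rightarrow> real set) \<Rightarrow> (real set \<Rightarrow> enat) \<Rightarrow> bool" where
  "enumerates I B \<longleftrightarrow>
     (\<forall>i. I i \<in> Int_bco) \<and>
     (\<forall>J\<in>Int_hat_bco. B J = (if finite {i. I i = J} then enat (card {i. I i = J}) else \<infinity>)) \<and>
     (\<forall>i. I i = {} \<longrightarrow> I (Suc i) = {})"

lemma ex_enumerates:
  assumes "B \<in> countable_barcodes"
  shows "\<exists>I. enumerates I B"
proof -
  define S where "S = {(J, k). enat k < B J}"
  have supp: "{I. B I \<noteq> 0} \<subseteq> Int_hat_bco" "countable {I. B I \<noteq> 0}"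
    using assms by (auto simp: countable_barcodes_def)
  have "S \<subseteq> {I. B I \<noteq> 0} \<times> UNIV"
    by (auto simp: S_def)
  then have cS: "countable S"
    by (rule countable_subset) (use supp in auto)
  obtain A :: "nat set" and h where h: "bij_betw h A S"
    and down: "\<And>i. Suc i \<in> A \<Longrightarrow> i \<in> A"
  proof (cases "finite S")
    case True
    then obtain h where "bij_betw h {0..<card S} S"
      using ex_bij_betw_nat_finite by blast
    then show ?thesis
      by (rule that) auto
  next
    case False
    then have "bij_betw (from_nat_into S) UNIV S"
      using bij_betw_from_nat_into cS by blast
    then show ?thesis
      by (rule that) auto
  qed
  define I where "I i = (if i \<in> A then fst (h i) else {})" for i
  have ne: "J \<noteq> {}" if "J \<in> Int_hat_bco" for J
    using that by (auto simp: Int_hat_bco_def)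
  have hI: "fst (h i) \<in> Int_hat_bco" if "i \<in> A" for i
  proof -
    have "h i \<in> S" using h that by (auto simp: bij_betw_def)
    then show ?thesis using supp by (cases "h i") (auto simp: S_def)
  qed
  have mult: "B J = (if finite {i. I i = J} then enat (card {i. I i = J}) else \<infinity>)"
    if J: "J \<in> Int_hat_bco" for J
  proof -
    have 1: "{i. I i = J} = {i\<in>A. fst (h i) = J}"
      using ne[OF J] by (auto simp: I_def)
    have im: "h ` {i\<in>A. fst (h i) = J} = {x\<in>S. fst x = J}"
      using bij_betw_imp_surj_on[OF h] by blast
    have 2: "bij_betw h {i\<in>A. fst (h i) = J} {x\<in>S. fst x = J}"
      by (rule bij_betw_subset[OF h _ im]) blast
    have 3: "bij_betw snd {x\<in>S. fst x = J} {k. enat k < B J}"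
      by (rule bij_betw_byWitness[where f' = "Pair J"]) (auto simp: S_def)
    have b: "bij_betw (snd \<circ> h) {i. I i = J} {k. enat k < B J}"
      unfolding 1 by (rule bij_betw_trans[OF 2 3])
    show ?thesis
    proof (cases "B J")
      case (enat n)
      then have "{k. enat k < B J} = {..<n}" by auto
      then show ?thesis
        using enat bij_betw_finite[OF b] bij_betw_same_card[OF b] by simp
    next
      case infinity
      then show ?thesis
        using bij_betw_finite[OF b] by simp
    qed
  qed
  have "enumerates I B"
    unfolding enumerates_def
  proof (intro conjI allI ballI impI)
    show "I i \<in> Int_bco" for i
      using hI by (auto simp: I_def Int_bco_def)
    show "I (Suc i) = {}" if "I i = {}" for i
      using that down hI ne by (auto simp: I_def split: if_splits)
  qed (rule mult)
  then show ?thesis by blast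
qed

text \<open>The notions below do not depend on which listing is chosen.\<close>

definition bars :: "(real set \<Rightarrow> enat) \<Rightarrow> nat \<Rightarrow> real set" where
  "bars B = (SOME I. enumerates I B)"

lemma enumerates_bars: "B \<in> countable_barcodes \<Longrightarrow> enumerates (bars B) B"
  unfolding bars_def by (rule someI_ex[OF ex_enumerates])

definition bar_indices :: "(real set \<Rightarrow> enat) \<Rightarrow> nat set" where
  "bar_indices B = {i. bars B i \<noteq> {}}"

definition p_finite :: "ennreal \<Rightarrow> (real set \<Rightarrow> enat) \<Rightarrow> bool" where
  "p_finite p B \<longleftrightarrow>
     finite (bar_indices B) \<or>
     (if p = \<infinity> then (\<lambda>i. bar_dist p (bars B i) {}) \<longlonglongrightarrow> 0
      else Lp_norm p (count_space UNIV) (\<lambda>i. bar_dist p (bars B i) {}) < \<infinity>)"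

definition p_finite_barcodes :: "ennreal \<Rightarrow> (real set \<Rightarrow> enat) set" where
  "p_finite_barcodes p = {B \<in> countable_barcodes. p_finite p B}"

section \<open>Wasserstein distance\<close>

definition padded :: "real set list \<Rightarrow> nat \<Rightarrow> real set" where
  "padded Is i = (if i < length Is then Is ! i else {})"

definition finite_wasserstein :: "ennreal \<Rightarrow> real set list \<Rightarrow> real set list \<Rightarrow> ennreal" where
  "finite_wasserstein p Is Js =
     Min ((\<lambda>\<sigma>. Lp_norm p (count_space {..<length Is + length Js})
                 (\<lambda>i. bar_dist p (padded Is i) (padded Js (\<sigma> i))))
          ` {\<sigma>. \<sigma> permutes {..<length Is + length Js}})"

definition initial_bars :: "(real set \<Rightarrow> enat) \<Rightarrow> nat \<Rightarrow> real set list" where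
  "initial_bars B n = map (bars B) [0..<n]"

definition wasserstein :: "ennreal \<Rightarrow> (real set \<Rightarrow> enat) \<Rightarrow> (real set \<Rightarrow> enat) \<Rightarrow> ennreal" where
  "wasserstein p B B' =
     (if finite (bar_indices B) \<and> finite (bar_indices B')
      then finite_wasserstein p (initial_bars B (card (bar_indices B)))
                                (initial_bars B' (card (bar_indices B')))
      else lim (\<lambda>n. finite_wasserstein p (initial_bars B n) (initial_bars B' n)))"

section \<open>Persistence landscape\<close>

text \<open>The \<open>k\<close>th largest element, with multiplicity and \<open>k \<ge> 1\<close>, of the family \<open>(a i)\<close> indexed by
  \<open>i \<in> A\<close>: fewer than \<open>k\<close> terms exceed it, and at least \<open>k\<close> terms are at least as large.\<close>

definition kth_largest :: "nat set \<Rightarrow> (nat \<Rightarrow> ennreal) \<Rightarrow> nat \<Rightarrow> ennreal" where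
  "kth_largest A a k =
     (THE x. x \<in> a ` A \<and>
        finite {i\<in>A. x < a i} \<and> card {i\<in>A. x < a i} < k \<and>
        (finite {i\<in>A. x \<le> a i} \<longrightarrow> k \<le> card {i\<in>A. x \<le> a i}))"

definition kmax_fin :: "nat \<Rightarrow> (nat \<Rightarrow> ennreal) \<Rightarrow> nat \<Rightarrow> ennreal" where
  "kmax_fin n a k = (if k \<le> n then kth_largest {..<n} a k else 0)"

definition kmax_inf :: "(nat \<Rightarrow> ennreal) \<Rightarrow> nat \<Rightarrow> ennreal" where
  "kmax_inf a k =
     (let L = limsup a; A = {i. L < a i} in
      if finite A then (if k \<le> card A then kth_largest A a k else L)
      else kth_largest UNIV a k)"

definition landscape :: "(real set \<Rightarrow> enat) \<Rightarrow> nat \<times> real \<Rightarrow> real" where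
  "landscape B = (\<lambda>(k, t).
     let a = (\<lambda>j. ennreal (triangle (bars B j) t)) in
     enn2real (if finite (bar_indices B) then kmax_fin (card (bar_indices B)) a k
               else kmax_inf a k))"

definition landscape_measure :: "(nat \<times> real) measure" where
  "landscape_measure = count_space {1..} \<Otimes>\<^sub>M lborel"

end

theory Submission
  imports Defs
begin

text \<open>
  The landscape at a point \<open>t\<close> lists the heights \<open>\<triangle>\<^bsub>I\<^esub>(t)\<close> of the bars in decreasing order, and
  sorting does not increase distances.  For finitely many bars and any matching, the rearrangement
  inequality for the convex function \<open>x \<mapsto> \<bar>x\<bar>\<^sup>p\<close> bounds \<open>\<Sum>\<^sub>k \<bar>\<Lambda>\<^sub>B(k,t) - \<Lambda>\<^bsub>B'\<^esub>(k,t)\<bar>\<^sup>p\<close> by the sum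
  of \<open>\<bar>\<triangle>\<^bsub>I\<^esub>(t) - \<triangle>\<^bsub>J\<^esub>(t)\<bar>\<^sup>p\<close> over the matched pairs \<open>(I, J)\<close>; integrating over \<open>t\<close> gives the
  \<open>p\<close>th power of the cost of the matching (\<open>sum_order_stat_le\<close>, \<open>landscape_matching_le\<close>).  For
  \<open>p = \<infinity>\<close> the uniform stability of sorting (\<open>order_stat_stable\<close>) takes the place of rearrangement.

  For infinite barcodes, an optimal matching of the first \<open>n\<close> bars extends to one of the first
  \<open>n + 1\<close> bars by sending the two new bars to the empty interval.  By \<open>p\<close>-finiteness the resulting
  error tends to \<open>0\<close>, so the distances of the truncations converge to a finite limit
  (\<open>wass_convergent\<close>).  The landscapes of the truncations converge pointwise, and Fatou's lemma
  carries the inequality over to the limit (\<open>seq_landscape_dist_le\<close>).  Comparison with the empty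
  barcode shows that landscapes are in \<open>L\<^sup>p\<close>.

  For injectivity, each \<open>\<Lambda>\<^sub>B(k, \<cdot>)\<close> is \<open>1\<close>-Lipschitz, so landscapes that agree almost everywhere agree
  everywhere.  For \<open>x > 0\<close>, \<open>x < \<Lambda>\<^sub>B(k,t)\<close> says that at least \<open>k\<close> bars contain \<open>[t - x, t + x]\<close> in
  their interior, so the landscape determines the number of bars \<open>[b,d)\<close> with \<open>b < u\<close> and \<open>v < d\<close> for
  all \<open>u < v\<close>.  These numbers are finite, and inclusion and exclusion with corners close to
  \<open>(b, d)\<close> recovers the multiplicity of \<open>[b,d)\<close> (\<open>copies_eq_of_landscape_eq\<close>).
\<close>

section \<open>Order statistics of vanishing sequences\<close>

text \<open>For nonnegative sequences this is convergence to \<open>0\<close>, in the form in which it is used: all the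
  counts below are finite.\<close>

definition vanishing :: "(nat \<Rightarrow> real) \<Rightarrow> bool" where
  "vanishing a \<longleftrightarrow> (\<forall>x>0. finite {i. x < a i})"

text \<open>The \<open>k\<close>th largest term for \<open>k \<ge> 1\<close>, defined from the counts of large terms so that finite and
  infinite sequences are treated alike; it is \<open>0\<close> when fewer than \<open>k\<close> terms are positive.  At \<open>k = 0\<close>
  the set is unbounded and the value carries no meaning.\<close>

definition order_stat :: "(nat \<Rightarrow> real) \<Rightarrow> nat \<Rightarrow> real" where
  "order_stat a k = Sup (insert 0 {x. 0 < x \<and> k \<le> card {i. x < a i}})"

lemma vanishingD: "vanishing a \<Longrightarrow> 0 < x \<Longrightarrow> finite {i. x < a i}"
  by (simp add: vanishing_def)

lemma bdd_above_order_stat: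
  assumes "vanishing a" "1 \<le> k"
  shows "bdd_above (insert 0 {x. 0 < x \<and> k \<le> card {i. x < a i}})"
proof -
  define F where "F = a ` {i. 1 < a i}"
  have F: "finite F"
    using vanishingD[OF assms(1), of 1] by (simp add: F_def)
  have "x \<le> Max (insert 1 F)" if x: "0 < x" "k \<le> card {i. x < a i}" for x
  proof -
    have "{i. x < a i} \<noteq> {}"
      using x assms(2) by (metis card.empty not_one_le_zero order_trans)
    then obtain i where i: "x < a i" by blast
    show ?thesis
    proof (cases "1 < a i")
      case True
      then have "a i \<le> Max (insert 1 F)" using F by (intro Max_ge) (auto simp: F_def)
      then show ?thesis using i by simp
    next
      case False
      then have "x \<le> 1" using i by simp
      also have "1 \<le> Max (insert 1 F)" using F by (intro Max_ge) auto
      finally show ?thesis .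
    qed
  qed
  moreover have "0 \<le> Max (insert 1 F)"
    using Max_ge[of "insert 1 F" 1] F by (simp add: order_trans[OF zero_le_one])
  ultimately show ?thesis
    by (intro bdd_aboveI[of _ "Max (insert 1 F)"]) auto
qed

lemma order_stat_nonneg: "vanishing a \<Longrightarrow> 1 \<le> k \<Longrightarrow> 0 \<le> order_stat a k"
  unfolding order_stat_def by (intro cSup_upper bdd_above_order_stat) auto

text \<open>The duality between order statistics and counts, through which stability and the
  evaluation on decreasing sequences are proved.\<close>

lemma less_order_stat_iff:
  assumes a: "vanishing a" and k: "1 \<le> k" and x: "0 < x"
  shows "x < order_stat a k \<longleftrightarrow> k \<le> card {i. x < a i}"
proof
  assume "x < order_stat a k"
  then obtain y where "x < y" "k \<le> card {i. y < a i}"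
    unfolding order_stat_def using x less_cSup_iff[OF _ bdd_above_order_stat[OF a k], of x] by auto
  moreover have "card {i. y < a i} \<le> card {i. x < a i}"
    using \<open>x < y\<close> by (intro card_mono vanishingD[OF a x]) auto
  ultimately show "k \<le> card {i. x < a i}" by (metis order_trans)
next
  assume le: "k \<le> card {i. x < a i}"
  define F where "F = {i. x < a i}"
  have "0 < card F" using le k unfolding F_def by linarith
  then have F: "finite F" "F \<noteq> {}"
    by (auto simp: card_gt_0_iff)
  define m where "m = Min (a ` F)"
  have m: "x < m" "\<And>i. i \<in> F \<Longrightarrow> m \<le> a i"
    using F unfolding m_def by (auto simp: F_def)
  define y where "y = (x + m) / 2"
  have y: "x < y" "y < m" using m by (auto simp: y_def)
  have "{i. y < a i} = F"
    using y m by (force simp: F_def)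
  then have "y \<le> order_stat a k"
    unfolding order_stat_def using le x y
    by (intro cSup_upper bdd_above_order_stat[OF a k]) (auto simp: F_def)
  then show "x < order_stat a k" using y by simp
qed

text \<open>Counts are recovered from the order statistics by taking \<open>k\<close> to be one of the counts.\<close>

lemma card_eq_of_order_stat_eq:
  assumes a: "vanishing a" and b: "vanishing b" and x: "0 < x"
    and eq: "\<And>k. 1 \<le> k \<Longrightarrow> order_stat a k = order_stat b k"
  shows "card {i. x < a i} = card {i. x < b i}"
proof -
  have le: "card {i. x < f i} \<le> card {i. x < g i}"
    if f: "vanishing f" and g: "vanishing g" and fg: "\<And>k. 1 \<le> k \<Longrightarrow> order_stat f k = order_stat g k" for f g
  proof (cases "1 \<le> card {i. x < f i}")
    case True
    have "x < order_stat f (card {i. x < f i})"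
      by (rule less_order_stat_iff[OF f True x, THEN iffD2]) simp
    then show ?thesis
      unfolding fg[OF True] by (rule less_order_stat_iff[OF g True x, THEN iffD1])
  qed simp
  show ?thesis
    by (rule antisym) (rule le[OF a b eq], assumption, rule le[OF b a eq[symmetric]], assumption)
qed

lemma order_stat_eqI:
  assumes "vanishing a" "1 \<le> k" "0 \<le> y"
    and "\<And>x. 0 < x \<Longrightarrow> x < y \<longleftrightarrow> k \<le> card {i. x < a i}"
  shows "order_stat a k = y"
proof (rule ccontr)
  assume "order_stat a k \<noteq> y"
  then consider "order_stat a k < y" | "y < order_stat a k" by (rule linorder_neqE)
  then show False
  proof cases
    case 1
    then obtain x where x: "order_stat a k < x" "x < y" by (rule dense[THEN exE]) blast
    have x0: "0 < x" using order_stat_nonneg[OF assms(1,2)] x(1) by (rule order_le_less_trans)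
    have "x < order_stat a k"
      using x(2) assms(4)[OF x0] less_order_stat_iff[OF assms(1,2) x0] by blast
    with x(1) show False by (rule less_asym)
  next
    case 2
    then obtain x where x: "y < x" "x < order_stat a k" by (rule dense[THEN exE]) blast
    have x0: "0 < x" using assms(3) x(1) by (rule order_le_less_trans)
    have "x < y"
      using x(2) assms(4)[OF x0] less_order_stat_iff[OF assms(1,2) x0] by blast
    with x(1) show False by (rule less_asym)
  qed
qed

text \<open>A term of \<open>a\<close> above \<open>x + e\<close> forces the term of \<open>b\<close> with the same index above \<open>x\<close>, so the count for
  \<open>b\<close> at level \<open>x\<close> is at least the count for \<open>a\<close> at level \<open>x + e\<close>.\<close>

lemma order_stat_le_add:
  assumes ab: "vanishing a" "vanishing b" and k: "1 \<le> k" and e: "0 \<le> e"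
    and le: "\<And>i. a i \<le> b i + e"
  shows "order_stat a k \<le> order_stat b k + e"
proof (rule ccontr)
  assume "\<not> ?thesis"
  then have "order_stat b k < order_stat a k - e" by simp
  then obtain x where x: "order_stat b k < x" "x < order_stat a k - e" using dense by blast
  have x0: "0 < x" using order_stat_nonneg[OF ab(2) k] x by simp
  have "k \<le> card {i. x + e < a i}"
    using less_order_stat_iff[OF ab(1) k, of "x + e"] x x0 e by simp
  also have "\<dots> \<le> card {i. x < b i}"
  proof (intro card_mono vanishingD[OF ab(2) x0] subsetI CollectI)
    fix i assume "i \<in> {i. x + e < a i}"
    then show "x < b i" using le[of i] by simp
  qed
  finally have "x < order_stat b k"
    by (rule less_order_stat_iff[OF ab(2) k x0, THEN iffD2])
  with x(1) show False by (rule less_asym)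
qed

lemma order_stat_stable:
  assumes ab: "vanishing a" "vanishing b" and k: "1 \<le> k"
    and le: "\<And>i. \<bar>a i - b i\<bar> \<le> e"
  shows "\<bar>order_stat a k - order_stat b k\<bar> \<le> e"
proof -
  have e: "0 \<le> e" using le[of 0] by linarith
  have le': "a i \<le> b i + e" "b i \<le> a i + e" for i using le[of i] by linarith+
  from order_stat_le_add[OF ab k e le'(1)] order_stat_le_add[OF ab(2,1) k e le'(2)]
  show ?thesis by linarith
qed

lemma card_less_comp_bij:
  assumes "bij s" shows "card {i. x < a (s i)} = card {i. x < (a i :: real)}"
proof -
  have "card (s -` {i. x < a i}) = card {i. x < a i}"
    using assms by (intro card_vimage_inj) (auto simp: bij_def)
  then show ?thesis by (simp only: vimage_Collect_eq)
qed

lemma order_stat_comp_bij: "bij s \<Longrightarrow> order_stat (\<lambda>i. a (s i)) k = order_stat a k"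
  by (simp add: order_stat_def card_less_comp_bij)

lemma vanishing_finite_support:
  assumes "\<And>i. i \<ge> N \<Longrightarrow> a i = 0" shows "vanishing a"
  unfolding vanishing_def
proof (intro allI impI)
  fix x :: real assume x: "0 < x"
  have "{i. x < a i} \<subseteq> {..<N}"
  proof
    fix i assume "i \<in> {i. x < a i}"
    then have "a i \<noteq> 0" using x by auto
    then show "i \<in> {..<N}" using assms[of i] by fastforce
  qed
  then show "finite {i. x < a i}" by (rule finite_subset) simp
qed

lemma order_stat_antimono:
  assumes f: "vanishing f" "antimono f" "\<And>i. 0 \<le> f i" and k: "1 \<le> k"
  shows "order_stat f k = f (k - 1)"
proof (rule order_stat_eqI[OF f(1) k])
  show "0 \<le> f (k - 1)" by (rule f)
  fix x :: real assume x: "0 < x"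
  have fin: "finite {i. x < f i}" by (rule vanishingD[OF f(1) x])
  show "x < f (k - 1) \<longleftrightarrow> k \<le> card {i. x < f i}"
  proof
    assume *: "x < f (k - 1)"
    have "{..<k} \<subseteq> {i. x < f i}"
    proof
      fix i assume "i \<in> {..<k}"
      then have "f (k - 1) \<le> f i" by (intro antimonoD[OF f(2)]) auto
      then show "i \<in> {i. x < f i}" using * by simp
    qed
    from card_mono[OF fin this] show "k \<le> card {i. x < f i}" by simp
  next
    assume *: "k \<le> card {i. x < f i}"
    show "x < f (k - 1)"
    proof (rule ccontr)
      assume n: "\<not> x < f (k - 1)"
      have "{i. x < f i} \<subseteq> {..<k - 1}"
      proof
        fix i assume i: "i \<in> {i. x < f i}"
        have "i < k - 1"
        proof (rule ccontr)
          assume "\<not> i < k - 1"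
          then have "f i \<le> f (k - 1)" by (intro antimonoD[OF f(2)]) auto
          then show False using i n by simp
        qed
        then show "i \<in> {..<k - 1}" by simp
      qed
      from card_mono[OF _ this] show False using * k by simp
    qed
  qed
qed

lemma ex_sorting_permutation:
  fixes a :: "nat \<Rightarrow> real"
  obtains s where "s permutes {..<N}" "\<And>i j. i \<le> j \<Longrightarrow> j < N \<Longrightarrow> a (s j) \<le> a (s i)"
proof -
  define xs where "xs = sort_key (\<lambda>i. - a i) [0..<N]"
  define s where "s i = (if i < N then xs ! i else i)" for i
  have xs: "length xs = N" "set xs = {..<N}" "distinct xs" "sorted (map (\<lambda>i. - a i) xs)"
    by (auto simp: xs_def)
  have "bij_betw ((!) xs) {..<N} {..<N}"
    by (rule bij_betw_nth[OF xs(3)]) (simp_all only: xs(1,2))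
  moreover have "bij_betw s {..<N} {..<N} = bij_betw ((!) xs) {..<N} {..<N}"
    by (rule bij_betw_cong) (simp add: s_def)
  ultimately have "bij_betw s {..<N} {..<N}" by simp
  then have 1: "s permutes {..<N}"
    by (rule bij_imp_permutes) (auto simp: s_def)
  have "a (s j) \<le> a (s i)" if "i \<le> j" "j < N" for i j
    using sorted_nth_mono[OF xs(4), of i j] that xs(1) by (simp add: s_def)
  with 1 show ?thesis by (rule that)
qed

section \<open>A rearrangement inequality\<close>

text \<open>Both \<open>x - y\<close> and \<open>x' - y'\<close> lie between \<open>x' - y\<close> and \<open>x - y'\<close>, and the two pairs have the same
  sum: uncrossing a pair of matched terms moves the differences inwards.\<close>

lemma convex_on_four_points:
  fixes \<phi> :: "real \<Rightarrow> real"
  assumes c: "convex_on UNIV \<phi>" and x: "x' \<le> x" and y: "y' \<le> y"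
  shows "\<phi> (x - y) + \<phi> (x' - y') \<le> \<phi> (x - y') + \<phi> (x' - y)"
proof (cases "x' - y = x - y'")
  case True
  then have "x = x'" "y = y'" using x y by auto
  then show ?thesis by simp
next
  case False
  define lo hi where "lo = x' - y" and "hi = x - y'"
  have lh: "lo < hi" using False x y by (auto simp: lo_def hi_def)
  define s where "s = (x - x') / (hi - lo)"
  have s: "0 \<le> s" "s \<le> 1" using lh x y by (auto simp: s_def lo_def hi_def field_simps)
  have sx: "s * (hi - lo) = x - x'" using lh by (simp add: s_def)
  have 1: "x - y = (1 - s) * lo + s * hi"
    using sx by (simp add: algebra_simps lo_def)
  have 2: "x' - y' = s * lo + (1 - s) * hi"
    using sx by (simp add: algebra_simps hi_def)
  have "\<phi> (x - y) \<le> (1 - s) * \<phi> lo + s * \<phi> hi"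
    unfolding 1 using convex_onD[OF c, of s lo hi] s by simp
  moreover have "\<phi> (x' - y') \<le> s * \<phi> lo + (1 - s) * \<phi> hi"
    unfolding 2 using convex_onD[OF c, of "1 - s" lo hi] s by simp
  ultimately have "\<phi> (x - y) + \<phi> (x' - y') \<le> ((1 - s) * \<phi> lo + s * \<phi> hi) + (s * \<phi> lo + (1 - s) * \<phi> hi)"
    by (rule add_mono)
  also have "\<dots> = \<phi> hi + \<phi> lo" by (simp add: algebra_simps)
  finally show ?thesis by (simp add: lo_def hi_def)
qed

text \<open>Induction on the length: one uncrossing makes the permutation fix the last index, where both
  sequences have their smallest term.\<close>

lemma rearrangement_antitone:
  fixes f g :: "nat \<Rightarrow> real" and \<phi> :: "real \<Rightarrow> real" and n :: nat
  assumes c: "convex_on UNIV \<phi>"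
  shows "\<tau> permutes {..<n} \<Longrightarrow> (\<And>i j. i \<le> j \<Longrightarrow> j < n \<Longrightarrow> f j \<le> f i) \<Longrightarrow>
    (\<And>i j. i \<le> j \<Longrightarrow> j < n \<Longrightarrow> g j \<le> g i) \<Longrightarrow>
    (\<Sum>i<n. \<phi> (f i - g i)) \<le> (\<Sum>i<n. \<phi> (f i - g (\<tau> i)))"
proof (induction n arbitrary: \<tau>)
  case 0
  then show ?case by simp
next
  case (Suc n)
  have lt: "\<tau> i < Suc n \<longleftrightarrow> i < Suc n" for i
    using permutes_in_image[OF Suc.prems(1), of i] by simp
  have inj: "\<tau> i = \<tau> j \<longleftrightarrow> i = j" for i j
    using permutes_inj[OF Suc.prems(1)] by (auto dest: injD)
  have IH: "(\<Sum>i<n. \<phi> (f i - g i)) \<le> (\<Sum>i<n. \<phi> (f i - g (\<tau>' i)))" if "\<tau>' permutes {..<n}" for \<tau>'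
    using that Suc.prems(2,3) by (intro Suc.IH) auto
  show ?case
  proof (cases "\<tau> n = n")
    case True
    have "\<tau> permutes {..<n}"
    proof (rule permutes_superset[OF Suc.prems(1)])
      show "\<tau> x = x" if "x \<in> {..<Suc n} - {..<n}" for x
        using True that by (auto simp: less_Suc_eq)
    qed
    from IH[OF this] show ?thesis by (simp add: True)
  next
    case False
    define j where "j = \<tau> n"
    have j: "j < n" using False lt[of n] by (auto simp: j_def)
    obtain i0 where i0: "\<tau> i0 = n"
      using permutes_surj[OF Suc.prems(1)] by (metis surjD)
    have i0n: "i0 < n" using i0 lt[of i0] False by (cases "i0 = n") auto
    (* After this swap the last terms of f and g are matched with each other; only the partner
       of index i0 changes besides. *)
    define \<tau>' where "\<tau>' = Transposition.transpose n j \<circ> \<tau>"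
    have "\<tau>' permutes {..<Suc n}"
      unfolding \<tau>'_def using j by (intro permutes_compose[OF Suc.prems(1)] permutes_swap_id) auto
    then have p: "\<tau>' permutes {..<n}"
      by (rule permutes_superset) (auto simp: less_Suc_eq \<tau>'_def j_def)
    have \<tau>'i0: "\<tau>' i0 = j" by (simp add: \<tau>'_def i0)
    have \<tau>'o: "\<tau>' i = \<tau> i" if "i < n" "i \<noteq> i0" for i
      using that inj[of i n] inj[of i i0] i0 by (auto simp: \<tau>'_def j_def Transposition.transpose_def)
    have split: "(\<Sum>i<n. F i) = F i0 + (\<Sum>i\<in>{..<n} - {i0}. F i)" for F :: "nat \<Rightarrow> real"
      using i0n by (simp add: sum.remove)
    have "(\<Sum>i<Suc n. \<phi> (f i - g i)) \<le> (\<Sum>i<n. \<phi> (f i - g (\<tau>' i))) + \<phi> (f n - g n)"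
      using IH[OF p] by simp
    also have "\<dots> = (\<phi> (f i0 - g j) + \<phi> (f n - g n)) + (\<Sum>i\<in>{..<n} - {i0}. \<phi> (f i - g (\<tau> i)))"
      unfolding split by (simp add: \<tau>'i0 \<tau>'o)
    also have "\<phi> (f i0 - g j) + \<phi> (f n - g n) \<le> \<phi> (f i0 - g n) + \<phi> (f n - g j)"
      using Suc.prems(2)[of i0 n] Suc.prems(3)[of j n] i0n j by (intro convex_on_four_points[OF c]) auto
    also have "(\<phi> (f i0 - g n) + \<phi> (f n - g j)) + (\<Sum>i\<in>{..<n} - {i0}. \<phi> (f i - g (\<tau> i)))
       = (\<Sum>i<Suc n. \<phi> (f i - g (\<tau> i)))"
      using split[of "\<lambda>i. \<phi> (f i - g (\<tau> i))"] by (simp add: i0 j_def)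
    finally show ?thesis by simp
  qed
qed

lemma order_stat_zero_beyond:
  assumes "\<And>i. i \<ge> N \<Longrightarrow> a i = 0" "N < k"
  shows "order_stat a k = 0"
proof (rule order_stat_eqI)
  fix x :: real assume x: "0 < x"
  have "{i. x < a i} \<subseteq> {..<N}"
  proof
    fix i assume "i \<in> {i. x < a i}"
    then show "i \<in> {..<N}" using assms(1)[of i] x by (cases "i \<ge> N") auto
  qed
  from card_mono[OF _ this] show "x < 0 \<longleftrightarrow> k \<le> card {i. x < a i}"
    using x assms(2) by simp
qed (use assms in \<open>auto intro: vanishing_finite_support\<close>)

lemma order_stat_sorted:
  assumes "\<And>i. 0 \<le> a i" "\<And>i. i \<ge> N \<Longrightarrow> a i = 0" "s permutes {..<N}"
    "\<And>i j. i \<le> j \<Longrightarrow> j < N \<Longrightarrow> a (s j) \<le> a (s i)" "i < N"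
  shows "order_stat a (Suc i) = a (s i)"
proof -
  have z: "a (s i) = 0" if "i \<ge> N" for i
    using assms(2,3) that by (simp add: permutes_not_in)
  have "antimono (\<lambda>i. a (s i))"
  proof (rule antimonoI)
    fix i j :: nat assume "i \<le> j"
    then show "a (s j) \<le> a (s i)"
      using assms(4)[of i j] assms(1)[of "s i"] z[of j] by (cases "j < N") auto
  qed
  then have "order_stat (\<lambda>i. a (s i)) (Suc i) = a (s i)"
    using order_stat_antimono[of "\<lambda>i. a (s i)" "Suc i"] vanishing_finite_support[of N "\<lambda>i. a (s i)"] z assms(1)
    by simp
  then show ?thesis
    using order_stat_comp_bij[OF permutes_bij[OF assms(3)], of a "Suc i"] by simp
qed

text \<open>Sorting \<open>a\<close> and \<open>b\<close> turns the identity matching into some permutation between the two decreasing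
  rearrangements, and the order statistics realise the identity between these.\<close>

lemma sum_order_stat_le:
  fixes \<phi> :: "real \<Rightarrow> real"
  assumes c: "convex_on UNIV \<phi>"
    and a: "\<And>i. 0 \<le> a i" "\<And>i. i \<ge> N \<Longrightarrow> a i = 0"
    and b: "\<And>i. 0 \<le> b i" "\<And>i. i \<ge> N \<Longrightarrow> b i = 0"
  shows "(\<Sum>i<N. \<phi> (order_stat a (Suc i) - order_stat b (Suc i))) \<le> (\<Sum>i<N. \<phi> (a i - b i))"
proof -
  obtain s where s: "s permutes {..<N}" "\<And>i j. i \<le> j \<Longrightarrow> j < N \<Longrightarrow> a (s j) \<le> a (s i)"
    using ex_sorting_permutation[of N a] by blast
  obtain r where r: "r permutes {..<N}" "\<And>i j. i \<le> j \<Longrightarrow> j < N \<Longrightarrow> b (r j) \<le> b (r i)"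
    using ex_sorting_permutation[of N b] by blast
  have t: "inv r \<circ> s permutes {..<N}"
    using s r by (intro permutes_compose permutes_inv)
  have "(\<Sum>i<N. \<phi> (order_stat a (Suc i) - order_stat b (Suc i))) = (\<Sum>i<N. \<phi> (a (s i) - b (r i)))"
    by (intro sum.cong refl) (simp add: order_stat_sorted[where s = s and a = a and N = N, OF a s] order_stat_sorted[where s = r and a = b and N = N, OF b r])
  also have "\<dots> \<le> (\<Sum>i<N. \<phi> (a (s i) - b (r ((inv r \<circ> s) i))))"
    using rearrangement_antitone[OF c t, of "\<lambda>i. a (s i)" "\<lambda>i. b (r i)"] s(2) r(2) by simp
  also have "\<dots> = (\<Sum>i<N. \<phi> (a (s i) - b (s i)))"
    using permutes_inverses[OF r(1)] by simp
  also have "\<dots> = (\<Sum>i<N. \<phi> (a i - b i))"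
    using sum.permute[OF s(1), of "\<lambda>i. \<phi> (a i - b i)"] by (simp add: o_def)
  finally show ?thesis .
qed

text \<open>The convexity of \<open>x powr r\<close> on the positive half line leaves the points with a coordinate \<open>0\<close>;
  there \<open>(c w)\<^sup>r \<le> c w\<^sup>r\<close> for \<open>0 < c < 1\<close> suffices.\<close>

lemma convex_on_abs_powr:
  assumes r: "1 \<le> r"
  shows "convex_on UNIV (\<lambda>x::real. \<bar>x\<bar> powr r)"
proof (rule convex_onI)
  fix t x y :: real assume t: "0 < t" "t < 1"
  define u v where "u = \<bar>x\<bar>" and "v = \<bar>y\<bar>"
  have uv: "0 \<le> u" "0 \<le> v" by (auto simp: u_def v_def)
  have shrink: "(c * w) powr r \<le> c * w powr r" if "0 < c" "c < 1" "0 \<le> w" for c w :: real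
  proof -
    have "c powr r \<le> c powr 1" using that r by (intro powr_mono') auto
    then show ?thesis using that by (simp add: powr_mult mult_right_mono)
  qed
  have "\<bar>(1 - t) *\<^sub>R x + t *\<^sub>R y\<bar> \<le> \<bar>(1 - t) * x\<bar> + \<bar>t * y\<bar>"
    using abs_triangle_ineq[of "(1 - t) * x" "t * y"] by simp
  then have "\<bar>(1 - t) *\<^sub>R x + t *\<^sub>R y\<bar> powr r \<le> ((1 - t) * u + t * v) powr r"
    using t r by (intro powr_mono2) (auto simp: u_def v_def abs_mult)
  also have "\<dots> \<le> (1 - t) * u powr r + t * v powr r"
  proof (cases "u = 0 \<or> v = 0")
    case True
    then show ?thesis using shrink[of t v] shrink[of "1 - t" u] t uv r by auto
  next
    case False
    then show ?thesis
      using convex_onD[OF powr_convex[OF r], of t u v] t uv by simp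
  qed
  finally show "\<bar>(1 - t) *\<^sub>R x + t *\<^sub>R y\<bar> powr r \<le> (1 - t) * \<bar>x\<bar> powr r + t * \<bar>y\<bar> powr r"
    by (simp add: u_def v_def)
qed simp

section \<open>Powers of extended nonnegative reals and \<open>L\<^sup>p\<close> norms\<close>

lemma ennpowr_ennreal: "0 \<le> x \<Longrightarrow> ennpowr (ennreal x) r = ennreal (x powr r)"
  by (simp add: ennpowr_def)

lemma ennpowr_top [simp]: "ennpowr top r = top"
  by (simp add: ennpowr_def)

lemma ennpowr_0 [simp]: "ennpowr 0 r = 0"
  by (simp add: ennpowr_def)

lemma ennpowr_less_top_iff: "ennpowr x r < top \<longleftrightarrow> x < top"
  by (cases x) (auto simp: ennpowr_ennreal)

lemma ennpowr_mono: "x \<le> y \<Longrightarrow> 0 \<le> r \<Longrightarrow> ennpowr x r \<le> ennpowr y r"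
  by (cases x; cases y) (auto simp: ennpowr_ennreal top_unique intro!: ennreal_leI powr_mono2)

lemma ennpowr_ennpowr_inverse: "0 < r \<Longrightarrow> ennpowr (ennpowr x r) (1 / r) = x"
  by (cases x) (auto simp: ennpowr_ennreal powr_powr)

lemma ennpowr_inverse_ennpowr: "0 < r \<Longrightarrow> ennpowr (ennpowr x (1 / r)) r = x"
  by (cases x) (auto simp: ennpowr_ennreal powr_powr)

lemma tendsto_ennpowr:
  assumes f: "(f \<longlongrightarrow> L) F" and L: "L < top" and r: "0 < r"
  shows "((\<lambda>x. ennpowr (f x) r) \<longlongrightarrow> ennpowr L r) F"
proof -
  have ev: "\<forall>\<^sub>F x in F. f x < top"
    by (rule order_tendstoD(2)[OF f L])
  have 1: "((\<lambda>x. ennreal (enn2real (f x) powr r)) \<longlongrightarrow> ennreal (enn2real L powr r)) F"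
    using r L tendsto_enn2real[of f "enn2real L" F] f
    by (intro tendsto_ennrealI tendsto_powr' tendsto_const) auto
  have 2: "ennpowr L r = ennreal (enn2real L powr r)"
    using L by (auto simp: ennpowr_def)
  have 3: "\<forall>\<^sub>F x in F. ennreal (enn2real (f x) powr r) = ennpowr (f x) r"
    using ev by eventually_elim (auto simp: ennpowr_def)
  from Lim_transform_eventually[OF 1 3] show ?thesis by (simp only: 2)
qed

lemma measurable_ennpowr [measurable (raw)]:
  assumes [measurable]: "f \<in> borel_measurable M"
  shows "(\<lambda>x. ennpowr (f x) r) \<in> borel_measurable M"
  unfolding ennpowr_def by measurable

lemma one_le_enn2real: "1 \<le> p \<Longrightarrow> p \<noteq> \<infinity> \<Longrightarrow> 1 \<le> enn2real p"
  by (cases p) auto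

lemma ennpowr_Lp_norm:
  assumes "1 \<le> p" "p \<noteq> \<infinity>"
  shows "ennpowr (Lp_norm p M f) (enn2real p) = (\<integral>\<^sup>+ x. ennpowr (f x) (enn2real p) \<partial>M)"
  using assms(2) one_le_enn2real[OF assms] ennpowr_inverse_ennpowr[of "enn2real p"]
  by (auto simp: Lp_norm_def)

lemma ennpowr_le_iff: "0 < r \<Longrightarrow> ennpowr x r \<le> ennpowr y r \<longleftrightarrow> x \<le> y"
  using ennpowr_mono[of x y r] ennpowr_mono[of "ennpowr x r" "ennpowr y r" "1 / r"]
  by (auto simp: ennpowr_ennpowr_inverse)

lemma Lp_norm_le_iff:
  assumes "1 \<le> p" "p \<noteq> \<infinity>"
  shows "Lp_norm p M f \<le> c \<longleftrightarrow> (\<integral>\<^sup>+ x. ennpowr (f x) (enn2real p) \<partial>M) \<le> ennpowr c (enn2real p)"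
  using one_le_enn2real[OF assms] ennpowr_le_iff[of "enn2real p" "Lp_norm p M f" c]
  by (simp add: ennpowr_Lp_norm[OF assms])

section \<open>Triangle functions\<close>

lemma Int_bco_cases:
  assumes "I \<in> Int_bco"
  obtains "I = {}" | b d where "b < d" "I = {b..<d}"
  using assms by (auto simp: Int_bco_def Int_hat_bco_def)

text \<open>As a distance to a set, the triangle function is nonnegative and \<open>1\<close>-Lipschitz.\<close>

lemma triangle_eq_infdist:
  assumes "I \<in> Int_bco"
  shows "triangle I t = infdist t (- I)"
proof -
  have "- I \<noteq> {}"
    using assms
  proof (cases rule: Int_bco_cases)
    case (2 b d)
    then have "d \<in> - I" by simp
    then show ?thesis by blast
  qed simp
  then show ?thesis
    by (simp add: triangle_def infdist_def dist_real_def Compl_eq_Diff_UNIV)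
qed

lemma triangle_nonneg: "I \<in> Int_bco \<Longrightarrow> 0 \<le> triangle I t"
  by (simp add: triangle_eq_infdist infdist_nonneg)

lemma triangle_lipschitz: "I \<in> Int_bco \<Longrightarrow> \<bar>triangle I s - triangle I t\<bar> \<le> \<bar>s - t\<bar>"
  using infdist_triangle_abs[of s "- I" t] by (simp add: triangle_eq_infdist dist_real_def)

lemma empty_in_Int_bco [simp]: "{} \<in> Int_bco"
  by (simp add: Int_bco_def)

lemma triangle_empty [simp]: "triangle {} t = 0"
  by (simp add: triangle_eq_infdist)

lemma measurable_triangle [measurable (raw)]:
  assumes "I \<in> Int_bco" shows "triangle I \<in> borel_measurable borel"
proof -
  have "triangle I = (\<lambda>t. infdist t (- I))" using assms by (auto simp: triangle_eq_infdist)
  then show ?thesis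
    by (auto intro!: borel_measurable_continuous_onI continuous_intros)
qed

text \<open>The graph of \<open>\<triangle>\<^bsub>I\<^esub>\<close> lies above height \<open>x\<close> at \<open>t\<close> exactly when \<open>[t - x, t + x]\<close> lies in the interior
  of \<open>I\<close>.  This links landscapes to the endpoints of the bars.\<close>

lemma less_triangle_iff:
  assumes I: "I \<in> Int_bco" and x: "0 \<le> x"
  shows "x < triangle I t \<longleftrightarrow> I \<noteq> {} \<and> Inf I < t - x \<and> t + x < Sup I"
  using I
proof (cases rule: Int_bco_cases)
  case 1
  then show ?thesis using x by simp
next
  case (2 b d)
  have le: "triangle I t \<le> \<bar>t - a\<bar>" if "a \<notin> I" for a
    using infdist_le[of a "- I" t] that I by (simp add: triangle_eq_infdist dist_real_def)
  have "x < triangle I t \<longleftrightarrow> b < t - x \<and> t + x < d"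
  proof
    assume *: "x < triangle I t"
    have "t \<in> I"
      using le[of t] * x by (cases "t \<in> I") auto
    then have t: "b \<le> t" "t < d" using 2 by auto
    have "x < d - t" using le[of d] * 2 t by simp
    moreover have "b < t - x"
    proof (rule ccontr)
      assume "\<not> b < t - x"
      (* The left endpoint belongs to the interval, so the test point lies slightly below it. *)
      then have "\<bar>t - (b - (triangle I t - x) / 2)\<bar> < triangle I t"
        using * t by (simp add: abs_if field_simps)
      then show False using le[of "b - (triangle I t - x) / 2"] * 2 by auto
    qed
    ultimately show "b < t - x \<and> t + x < d" by simp
  next
    assume *: "b < t - x \<and> t + x < d"
    have "min (t - b) (d - t) \<le> infdist t (- I)"
    proof (subst infdist_notempty)
      show "- I \<noteq> {}" using 2 by auto
      show "min (t - b) (d - t) \<le> (INF a\<in>- I. dist t a)"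
        using 2 * x by (intro cINF_greatest) (auto simp: dist_real_def not_le not_less)
    qed
    then show "x < triangle I t" using * by (auto simp: triangle_eq_infdist[OF I])
  qed
  then show ?thesis using 2 by simp
qed

lemma bar_dist_self [simp]: "bar_dist p I I = 0"
  using esssup_const[of "lborel :: real measure" "0::ennreal"]
  by (simp add: bar_dist_def Lp_norm_def)

text \<open>The triangle function of \<open>[b,d)\<close> is bounded by \<open>d - b\<close> and supported in \<open>[b,d]\<close>.\<close>

lemma bar_dist_less_top:
  assumes I: "I \<in> Int_bco" and p: "1 \<le> p"
  shows "bar_dist p I {} < top"
  using I
proof (cases rule: Int_bco_cases)
  case 1
  then show ?thesis by simp
next
  case (2 b d)
  have le: "\<bar>triangle I t\<bar> \<le> (d - b) * indicator {b..d} t" for t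
  proof (rule ccontr)
    assume *: "\<not> ?thesis"
    have "0 \<le> (d - b) * indicator {b..d} t" using 2 by (simp add: indicator_def)
    with * less_triangle_iff[OF I this, of t] triangle_nonneg[OF I, of t] 2 show False
      by (cases "t \<in> {b..d}") auto
  qed
  have m[measurable]: "triangle I \<in> borel_measurable borel" using I by (rule measurable_triangle)
  show ?thesis
  proof (cases "p = \<infinity>")
    case True
    have le': "\<bar>triangle I t\<bar> \<le> d - b" for t
      using order_trans[OF le[of t], of "d - b"] 2 by (auto simp: indicator_def)
    have "esssup lborel (\<lambda>t. ennreal \<bar>triangle I t\<bar>) \<le> ennreal (d - b)"
      by (rule esssup_I) (auto intro!: ennreal_leI le' AE_I2)
    then show ?thesis
      using True by (simp add: bar_dist_def Lp_norm_def order_le_less_trans[OF _ ennreal_less_top])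
  next
    case False
    define r where "r = enn2real p"
    have r: "1 \<le> r" using one_le_enn2real[OF p False] by (simp add: r_def)
    have "(\<integral>\<^sup>+ t. ennpowr (ennreal \<bar>triangle I t\<bar>) r \<partial>lborel)
        \<le> (\<integral>\<^sup>+ t. ennreal ((d - b) powr r) * indicator {b..d} t \<partial>lborel)"
    proof (intro nn_integral_mono)
      fix t
      have "\<bar>triangle I t\<bar> powr r \<le> ((d - b) * indicator {b..d} t) powr r"
        using le[of t] r by (intro powr_mono2) auto
      then show "ennpowr (ennreal \<bar>triangle I t\<bar>) r \<le> ennreal ((d - b) powr r) * indicator {b..d} t"
        using r by (auto simp: ennpowr_ennreal indicator_def intro!: ennreal_leI)
    qed
    also have "\<dots> < top"
      using 2 by (simp add: nn_integral_cmult_indicator ennreal_mult_less_top less_imp_le)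
    finally have "ennpowr (bar_dist p I {}) r < top"
      by (simp add: bar_dist_def r_def ennpowr_Lp_norm[OF p False])
    then show ?thesis by (simp add: ennpowr_less_top_iff)
  qed
qed

text \<open>A triangle function with a value above \<open>x\<close> stays above \<open>x / 2\<close> on an interval of length \<open>x\<close>, since
  it is \<open>1\<close>-Lipschitz.  Hence \<open>p\<close>-finiteness leaves only finitely many bars of height above \<open>x\<close>.\<close>

lemma bar_dist_lower_bound:
  assumes p: "1 \<le> p" and x: "0 < x"
  obtains c :: ennreal where "0 < c"
    "\<And>I t. I \<in> Int_bco \<Longrightarrow> x < triangle I t \<Longrightarrow> c \<le> bar_dist p I {}"
proof -
  define r where "r = enn2real p"
  define c where "c = (if p = \<infinity> then ennreal (x / 2) else ennpowr (ennreal ((x / 2) powr r) * ennreal x) (1 / r))"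
  have r: "1 \<le> r" if "p \<noteq> \<infinity>" using one_le_enn2real[OF p that] by (simp add: r_def)
  have c: "0 < c"
    using x by (auto simp: c_def ennpowr_ennreal simp flip: ennreal_mult)
  have "c \<le> bar_dist p I {}" if I: "I \<in> Int_bco" and t: "x < triangle I t" for I t
  proof -
    note m[measurable] = measurable_triangle[OF I]
    have ge: "x / 2 \<le> \<bar>triangle I s\<bar>" if "s \<in> {t - x/2..t + x/2}" for s
      using triangle_lipschitz[OF I, of t s] t that by (auto simp: abs_le_iff)
    show ?thesis
    proof (cases "p = \<infinity>")
      case True
      show ?thesis
      proof (rule ccontr)
        assume *: "\<not> ?thesis"
        have "AE s in lborel. ennreal \<bar>triangle I s\<bar> \<le> bar_dist p I {}"
          using esssup_AE[of "\<lambda>t. ennreal \<bar>triangle I t\<bar>" lborel] True by (simp add: bar_dist_def Lp_norm_def)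
        then have "AE s in lborel. s \<notin> {t - x/2..t + x/2}"
        proof (rule AE_mp, intro AE_I2 impI notI)
          fix s assume 1: "ennreal \<bar>triangle I s\<bar> \<le> bar_dist p I {}" and 2: "s \<in> {t - x/2..t + x/2}"
          have "c \<le> ennreal \<bar>triangle I s\<bar>"
            using ge[OF 2] True by (simp add: c_def ennreal_leI)
          with 1 * show False by simp
        qed
        then have "emeasure lborel {t - x/2..t + x/2} = 0"
          by (subst (asm) AE_iff_measurable[of "{t - x/2..t + x/2}"]) auto
        then show False using x by simp
      qed
    next
      case False
      have "ennreal ((x / 2) powr r) * ennreal x
         = (\<integral>\<^sup>+ s. ennreal ((x / 2) powr r) * indicator {t - x/2..t + x/2} s \<partial>lborel)"
        using x by (subst nn_integral_cmult_indicator) auto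
      also have "\<dots> \<le> (\<integral>\<^sup>+ s. ennpowr (ennreal \<bar>triangle I s\<bar>) r \<partial>lborel)"
      proof (intro nn_integral_mono)
        fix s
        show "ennreal ((x / 2) powr r) * indicator {t - x/2..t + x/2} s \<le> ennpowr (ennreal \<bar>triangle I s\<bar>) r"
          using ge[of s] x r[OF False] by (auto simp: ennpowr_ennreal indicator_def intro!: ennreal_leI powr_mono2)
      qed
      finally have "c \<le> ennpowr (\<integral>\<^sup>+ s. ennpowr (ennreal \<bar>triangle I s\<bar>) r \<partial>lborel) (1 / r)"
        using False r[OF False] by (simp add: c_def ennpowr_mono)
      then show ?thesis using False by (simp add: bar_dist_def Lp_norm_def r_def)
    qed
  qed
  with c show ?thesis by (rule that)
qed

section \<open>Landscapes of sequences of bars\<close>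

text \<open>The landscape as a function of a listing of the bars: a truncated listing need not be the
  listing chosen for any barcode.\<close>

definition seq_landscape :: "(nat \<Rightarrow> real set) \<Rightarrow> nat \<times> real \<Rightarrow> real" where
  "seq_landscape I = (\<lambda>(k, t). order_stat (\<lambda>i. triangle (I i) t) k)"

definition vanishing_bars :: "(nat \<Rightarrow> real set) \<Rightarrow> bool" where
  "vanishing_bars I \<longleftrightarrow> range I \<subseteq> Int_bco \<and> (\<forall>t. vanishing (\<lambda>i. triangle (I i) t))"

lemma vanishing_barsD:
  assumes "vanishing_bars I"
  shows "I i \<in> Int_bco" "vanishing (\<lambda>i. triangle (I i) t)"
  using assms by (auto simp: vanishing_bars_def)

lemma vanishing_bars_finite_support:
  assumes "\<And>i. I i \<in> Int_bco" "\<And>i. i \<ge> N \<Longrightarrow> I i = {}"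
  shows "vanishing_bars I"
  using assms by (auto simp: vanishing_bars_def intro!: vanishing_finite_support[of N])

lemma pair_sigma_finite_landscape: "pair_sigma_finite (count_space {1::nat..}) (lborel :: real measure)"
  by (intro pair_sigma_finite.intro sigma_finite_measure_count_space lborel.sigma_finite_measure_axioms)

text \<open>By uniform stability, sorting preserves the common Lipschitz constant of the triangle functions.\<close>

lemma seq_landscape_lipschitz:
  assumes I: "vanishing_bars I" and k: "1 \<le> k"
  shows "\<bar>seq_landscape I (k, s) - seq_landscape I (k, t)\<bar> \<le> \<bar>s - t\<bar>"
  unfolding seq_landscape_def prod.case
  by (rule order_stat_stable[OF vanishing_barsD(2)[OF I] vanishing_barsD(2)[OF I] k
        triangle_lipschitz[OF vanishing_barsD(1)[OF I]]])

lemma continuous_seq_landscape: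
  assumes I: "vanishing_bars I" and k: "1 \<le> k"
  shows "continuous_on UNIV (\<lambda>t. seq_landscape I (k, t))"
proof (rule lipschitz_on_continuous_on)
  show "1-lipschitz_on UNIV (\<lambda>t. seq_landscape I (k, t))"
    using seq_landscape_lipschitz[OF I k] by (intro lipschitz_onI) (auto simp: dist_real_def)
qed

lemma measurable_seq_landscape [measurable (raw)]:
  assumes "vanishing_bars I"
  shows "seq_landscape I \<in> borel_measurable landscape_measure"
  unfolding landscape_measure_def
proof (rule measurable_pair_measure_countable1)
  fix k :: nat assume "k \<in> {1..}"
  then show "(\<lambda>t. seq_landscape I (k, t)) \<in> borel_measurable lborel"
    using continuous_seq_landscape[OF assms, of k] by (simp add: borel_measurable_continuous_onI)
qed simp

section \<open>Recovering multiplicities from the landscape\<close>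

text \<open>The indices of the bars that extend beyond \<open>u\<close> on the left and beyond \<open>v\<close> on the right.  The infimum
  and the supremum of the empty set are unspecified reals, whence the first condition.\<close>

definition spanning :: "(nat \<Rightarrow> real set) \<Rightarrow> real \<Rightarrow> real \<Rightarrow> nat set" where
  "spanning I u v = {i. I i \<noteq> {} \<and> Inf (I i) < u \<and> v < Sup (I i)}"

lemma spanning_eq_triangle:
  assumes "vanishing_bars I" "u < v"
  shows "spanning I u v = {i. (v - u) / 2 < triangle (I i) ((u + v) / 2)}"
proof -
  have "(u + v) / 2 - (v - u) / 2 = u" "(u + v) / 2 + (v - u) / 2 = v" by (auto simp: field_simps)
  then show ?thesis
    using less_triangle_iff[OF vanishing_barsD(1)[OF assms(1)], of "(v - u) / 2" _ "(u + v) / 2"] assms(2)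
    by (simp add: spanning_def)
qed

lemma finite_spanning:
  assumes "vanishing_bars I" "u < v" shows "finite (spanning I u v)"
  unfolding spanning_eq_triangle[OF assms]
  using assms(2) by (intro vanishingD[OF vanishing_barsD(2)[OF assms(1)]]) simp

text \<open>Only finitely many bars span the middle third of \<open>[b,d)\<close>.  For \<open>\<epsilon>\<close> below all the positive distances
  of their endpoints to \<open>b\<close> and \<open>d\<close>, such a bar with left endpoint in \<open>[b, b + \<epsilon>)\<close> and right endpoint in
  \<open>(d - \<epsilon>, d]\<close> is \<open>[b,d)\<close> itself.\<close>

lemma copies_eq_spanning:
  assumes I: "vanishing_bars I" and bd: "b < d"
  shows "\<exists>e>0. \<forall>\<epsilon>>0. \<epsilon> \<le> e \<longrightarrow> {i. I i = {b..<d}} =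
    spanning I (b + \<epsilon>) (d - \<epsilon>) - (spanning I b (d - \<epsilon>) \<union> spanning I (b + \<epsilon>) d)"
proof -
  define h where "h = (d - b) / 3"
  have h: "0 < h" "b + h < d - h" using bd by (auto simp: h_def field_simps)
  define F where "F = spanning I (b + h) (d - h)"
  have F: "finite F" unfolding F_def by (rule finite_spanning[OF I h(2)])
  define S where "S = insert h ({x. 0 < x} \<inter> ((\<lambda>i. Inf (I i) - b) ` F \<union> (\<lambda>i. d - Sup (I i)) ` F))"
  define e where "e = Min S"
  have S: "finite S" "S \<noteq> {}" "\<And>x. x \<in> S \<Longrightarrow> 0 < x" using F h by (auto simp: S_def)
  have e: "0 < e" unfolding e_def using S by simp
  have eS: "e \<le> x" if "x \<in> S" for x unfolding e_def using S that by simp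
  have "{i. I i = {b..<d}} =
    spanning I (b + \<epsilon>) (d - \<epsilon>) - (spanning I b (d - \<epsilon>) \<union> spanning I (b + \<epsilon>) d)"
    if \<epsilon>: "0 < \<epsilon>" "\<epsilon> \<le> e" for \<epsilon>
  proof (intro set_eqI iffI)
    fix i assume "i \<in> {i. I i = {b..<d}}"
    then show "i \<in> spanning I (b + \<epsilon>) (d - \<epsilon>) - (spanning I b (d - \<epsilon>) \<union> spanning I (b + \<epsilon>) d)"
      using bd \<epsilon> by (simp add: spanning_def)
  next
    fix i assume "i \<in> spanning I (b + \<epsilon>) (d - \<epsilon>) - (spanning I b (d - \<epsilon>) \<union> spanning I (b + \<epsilon>) d)"
    then have i: "I i \<noteq> {}" "Inf (I i) < b + \<epsilon>" "d - \<epsilon> < Sup (I i)" "b \<le> Inf (I i)" "Sup (I i) \<le> d"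
      by (auto simp: spanning_def)
    have "\<epsilon> \<le> h" using eS[of h] \<epsilon> by (simp add: S_def)
    then have iF: "i \<in> F" using i by (simp add: F_def spanning_def)
    have "Inf (I i) = b"
    proof (rule ccontr)
      assume "Inf (I i) \<noteq> b"
      then have "Inf (I i) - b \<in> S" using i iF by (simp add: S_def)
      from eS[OF this] \<epsilon> i show False by simp
    qed
    moreover have "Sup (I i) = d"
    proof (rule ccontr)
      assume "Sup (I i) \<noteq> d"
      then have "d - Sup (I i) \<in> S" using i iF by (simp add: S_def)
      from eS[OF this] \<epsilon> i show False by simp
    qed
    moreover have "I i = {Inf (I i)..<Sup (I i)}"
      using vanishing_barsD(1)[OF I, of i] i(1) by (cases rule: Int_bco_cases) auto
    ultimately show "i \<in> {i. I i = {b..<d}}" by simp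
  qed
  with e show ?thesis by blast
qed

lemma card_copies:
  assumes I: "vanishing_bars I" and \<epsilon>: "0 < \<epsilon>" "b + \<epsilon> < d - \<epsilon>"
    and eq: "{i. I i = {b..<d}} =
      spanning I (b + \<epsilon>) (d - \<epsilon>) - (spanning I b (d - \<epsilon>) \<union> spanning I (b + \<epsilon>) d)"
  shows "finite {i. I i = {b..<d}}"
    "card {i. I i = {b..<d}} = card (spanning I (b + \<epsilon>) (d - \<epsilon>))
       - (card (spanning I b (d - \<epsilon>)) + card (spanning I (b + \<epsilon>) d) - card (spanning I b d))"
proof -
  have fin: "finite (spanning I (b + \<epsilon>) (d - \<epsilon>))" "finite (spanning I b (d - \<epsilon>))" "finite (spanning I (b + \<epsilon>) d)"
    using \<epsilon> by (auto intro!: finite_spanning[OF I])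
  then show "finite {i. I i = {b..<d}}" by (simp add: eq)
  have int: "spanning I b (d - \<epsilon>) \<inter> spanning I (b + \<epsilon>) d = spanning I b d"
    using \<epsilon> by (auto simp: spanning_def)
  have sub: "spanning I b (d - \<epsilon>) \<union> spanning I (b + \<epsilon>) d \<subseteq> spanning I (b + \<epsilon>) (d - \<epsilon>)"
    using \<epsilon> by (auto simp: spanning_def)
  have "card (spanning I b (d - \<epsilon>) \<union> spanning I (b + \<epsilon>) d)
      = card (spanning I b (d - \<epsilon>)) + card (spanning I (b + \<epsilon>) d) - card (spanning I b d)"
    using card_Un_Int[OF fin(2,3)] by (simp add: int)
  then show "card {i. I i = {b..<d}} = card (spanning I (b + \<epsilon>) (d - \<epsilon>))
       - (card (spanning I b (d - \<epsilon>)) + card (spanning I (b + \<epsilon>) d) - card (spanning I b d))"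
    unfolding eq using card_Diff_subset[OF finite_subset[OF sub fin(1)] sub] by simp
qed

text \<open>Both families have the same counts of spanning bars, by duality with the order statistics; these
  counts determine the number of copies through the same inclusion and exclusion, with one \<open>\<epsilon>\<close> small
  enough for both.\<close>

lemma copies_eq_of_landscape_eq:
  assumes I: "vanishing_bars I" and J: "vanishing_bars J"
    and eq: "\<And>k t. 1 \<le> k \<Longrightarrow> seq_landscape I (k, t) = seq_landscape J (k, t)" and bd: "b < d"
  shows "finite {i. I i = {b..<d}}" "finite {i. J i = {b..<d}}"
    "card {i. I i = {b..<d}} = card {i. J i = {b..<d}}"
proof -
  obtain e1 where e1: "0 < e1" "\<And>\<epsilon>. 0 < \<epsilon> \<Longrightarrow> \<epsilon> \<le> e1 \<Longrightarrow> {i. I i = {b..<d}} =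
    spanning I (b + \<epsilon>) (d - \<epsilon>) - (spanning I b (d - \<epsilon>) \<union> spanning I (b + \<epsilon>) d)"
    using copies_eq_spanning[OF I bd] by blast
  obtain e2 where e2: "0 < e2" "\<And>\<epsilon>. 0 < \<epsilon> \<Longrightarrow> \<epsilon> \<le> e2 \<Longrightarrow> {i. J i = {b..<d}} =
    spanning J (b + \<epsilon>) (d - \<epsilon>) - (spanning J b (d - \<epsilon>) \<union> spanning J (b + \<epsilon>) d)"
    using copies_eq_spanning[OF J bd] by blast
  define \<epsilon> where "\<epsilon> = min (min e1 e2) ((d - b) / 3)"
  have le: "\<epsilon> \<le> e1" "\<epsilon> \<le> e2" "\<epsilon> \<le> (d - b) / 3"
    unfolding \<epsilon>_def by linarith+
  have \<epsilon>0: "0 < \<epsilon>" using e1(1) e2(1) bd by (simp add: \<epsilon>_def)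
  have \<epsilon>: "b + \<epsilon> < d - \<epsilon>" using le(3) \<epsilon>0 bd by (simp add: field_simps)
  note cI = card_copies[OF I \<epsilon>0 \<epsilon> e1(2)[OF \<epsilon>0 le(1)]]
  note cJ = card_copies[OF J \<epsilon>0 \<epsilon> e2(2)[OF \<epsilon>0 le(2)]]
  show "finite {i. I i = {b..<d}}" "finite {i. J i = {b..<d}}" by (fact cI(1), fact cJ(1))
  have s: "card (spanning I u v) = card (spanning J u v)" if uv: "u < v" for u v
    unfolding spanning_eq_triangle[OF I uv] spanning_eq_triangle[OF J uv]
  proof (rule card_eq_of_order_stat_eq[OF vanishing_barsD(2)[OF I] vanishing_barsD(2)[OF J]])
    show "0 < (v - u) / 2" using uv by simp
    fix k :: nat assume "1 \<le> k"
    from eq[OF this, of "(u + v) / 2"]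
    show "order_stat (\<lambda>i. triangle (I i) ((u + v) / 2)) k = order_stat (\<lambda>i. triangle (J i) ((u + v) / 2)) k"
      by (simp only: seq_landscape_def prod.case)
  qed
  have "b < d - \<epsilon>" "b + \<epsilon> < d" using \<epsilon> \<epsilon>0 by linarith+
  then show "card {i. I i = {b..<d}} = card {i. J i = {b..<d}}"
    unfolding cI(2) cJ(2) by (simp only: s \<epsilon> bd)
qed

lemma continuous_AE_eq_imp_eq:
  fixes f g :: "real \<Rightarrow> real"
  assumes f: "continuous_on UNIV f" and g: "continuous_on UNIV g" and ae: "AE t in lborel. f t = g t"
  shows "f t = g t"
proof (rule ccontr)
  assume t: "f t \<noteq> g t"
  define S where "S = {t. f t \<noteq> g t}"
  have "open S" unfolding S_def by (rule open_Collect_neq[OF f g])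
  moreover have "t \<in> S" using t by (simp add: S_def)
  ultimately obtain e where e: "0 < e" "ball t e \<subseteq> S" by (auto simp: open_contains_ball)
  have sub: "{t - e / 2..t + e / 2} \<subseteq> S"
    using e by (intro order_trans[OF _ e(2)]) (auto simp: dist_real_def abs_less_iff)
  have "S \<in> sets lborel" using \<open>open S\<close> by simp
  then have "emeasure lborel S = 0"
    using ae by (subst (asm) AE_iff_measurable[of S]) (auto simp: S_def)
  then have "emeasure lborel {t - e / 2..t + e / 2} \<le> 0"
    using emeasure_mono[OF sub \<open>S \<in> sets lborel\<close>] by simp
  then show False using e by simp
qed

section \<open>The finite inequality\<close>

text \<open>Almost every \<open>t\<close> satisfies the bounds for all matched pairs at once, and at such \<open>t\<close> uniform stability
  applies for every \<open>k\<close>.\<close>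

lemma landscape_matching_le_top:
  assumes I: "\<And>i. I i \<in> Int_bco" "\<And>i. i \<ge> N \<Longrightarrow> I i = {}"
    and J: "\<And>i. J i \<in> Int_bco" "\<And>i. i \<ge> N \<Longrightarrow> J i = {}"
  shows "esssup landscape_measure (\<lambda>x. ennreal \<bar>seq_landscape I x - seq_landscape J x\<bar>)
    \<le> esssup (count_space {..<N}) (\<lambda>i. bar_dist \<infinity> (I i) (J i))" (is "_ \<le> ?c")
proof (rule esssup_I)
  interpret pair_sigma_finite "count_space {1::nat..}" "lborel :: real measure"
    by (rule pair_sigma_finite_landscape)
  note v = vanishing_bars_finite_support[OF I] vanishing_bars_finite_support[OF J]
  show m[measurable]: "(\<lambda>x. ennreal \<bar>seq_landscape I x - seq_landscape J x\<bar>) \<in> borel_measurable landscape_measure"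
    using v by measurable
  have "AE t in lborel. ennreal \<bar>triangle (I i) t - triangle (J i) t\<bar> \<le> ?c" for i
  proof (cases "i < N")
    case True
    have "AE i in count_space {..<N}. bar_dist \<infinity> (I i) (J i) \<le> ?c" by (rule esssup_AE)
    then have "bar_dist \<infinity> (I i) (J i) \<le> ?c" using True by (simp add: AE_count_space)
    moreover have "AE t in lborel. ennreal \<bar>triangle (I i) t - triangle (J i) t\<bar> \<le> bar_dist \<infinity> (I i) (J i)"
      unfolding bar_dist_def Lp_norm_def by (simp add: esssup_AE)
    ultimately show ?thesis by (auto elim: eventually_mono)
  qed (simp add: I J)
  then have "AE t in lborel. \<forall>i. ennreal \<bar>triangle (I i) t - triangle (J i) t\<bar> \<le> ?c"
    by (simp add: AE_all_countable)
  then have ae: "AE t in lborel. ennreal \<bar>seq_landscape I (k, t) - seq_landscape J (k, t)\<bar> \<le> ?c" if "1 \<le> k" for k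
  proof (rule AE_mp, intro AE_I2 impI)
    fix t assume *: "\<forall>i. ennreal \<bar>triangle (I i) t - triangle (J i) t\<bar> \<le> ?c"
    show "ennreal \<bar>seq_landscape I (k, t) - seq_landscape J (k, t)\<bar> \<le> ?c"
    proof (cases ?c)
      case (real e)
      have "\<bar>triangle (I i) t - triangle (J i) t\<bar> \<le> e" for i
        using *[rule_format, of i] real by simp
      then show ?thesis
        unfolding real(2) seq_landscape_def prod.case
        by (intro ennreal_leI order_stat_stable vanishing_barsD(2) v that)
    qed simp
  qed
  show "AE x in landscape_measure. ennreal \<bar>seq_landscape I x - seq_landscape J x\<bar> \<le> ?c"
    unfolding landscape_measure_def
  proof (rule AE_pair_measure)
    show "{x \<in> space (count_space {1::nat..} \<Otimes>\<^sub>M lborel). ennreal \<bar>seq_landscape I x - seq_landscape J x\<bar> \<le> ?c}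
        \<in> sets (count_space {1::nat..} \<Otimes>\<^sub>M lborel)"
      unfolding landscape_measure_def[symmetric] by measurable
    show "AE k in count_space {1..}. AE t in lborel. ennreal \<bar>seq_landscape I (k, t) - seq_landscape J (k, t)\<bar> \<le> ?c"
      using ae by (simp add: AE_count_space)
  qed
qed

text \<open>Tonelli, with the sum over \<open>k\<close> inside, reduces the claim to the rearrangement inequality at each \<open>t\<close>.\<close>

lemma landscape_matching_le_powr:
  assumes r: "1 \<le> r"
    and I: "\<And>i. I i \<in> Int_bco" "\<And>i. i \<ge> N \<Longrightarrow> I i = {}"
    and J: "\<And>i. J i \<in> Int_bco" "\<And>i. i \<ge> N \<Longrightarrow> J i = {}"
  shows "(\<integral>\<^sup>+ x. ennpowr (ennreal \<bar>seq_landscape I x - seq_landscape J x\<bar>) r \<partial>landscape_measure)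
    \<le> (\<Sum>i<N. \<integral>\<^sup>+ t. ennpowr (ennreal \<bar>triangle (I i) t - triangle (J i) t\<bar>) r \<partial>lborel)"
proof -
  interpret pair_sigma_finite "count_space {1::nat..}" "lborel :: real measure"
    by (rule pair_sigma_finite_landscape)
  note v = vanishing_bars_finite_support[OF I] vanishing_bars_finite_support[OF J]
  note [measurable] = measurable_triangle[OF I(1)] measurable_triangle[OF J(1)]
  define F where "F x = ennpowr (ennreal \<bar>seq_landscape I x - seq_landscape J x\<bar>) r" for x
  have m: "F \<in> borel_measurable landscape_measure"
    unfolding F_def using v by measurable
  have pt: "(\<integral>\<^sup>+ k. F (k, t) \<partial>count_space {1..}) \<le> (\<Sum>i<N. ennpowr (ennreal \<bar>triangle (I i) t - triangle (J i) t\<bar>) r)" for t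
  proof -
    define a b where "a i = triangle (I i) t" and "b i = triangle (J i) t" for i
    have a: "0 \<le> a i" "i \<ge> N \<Longrightarrow> a i = 0" for i using I by (auto simp: a_def triangle_nonneg)
    have b: "0 \<le> b i" "i \<ge> N \<Longrightarrow> b i = 0" for i using J by (auto simp: b_def triangle_nonneg)
    have F: "F (k, t) = ennreal (\<bar>order_stat a k - order_stat b k\<bar> powr r)" for k
      by (simp add: F_def seq_landscape_def ennpowr_ennreal a_def[abs_def] b_def[abs_def])
    have "(\<integral>\<^sup>+ k. F (k, t) \<partial>count_space {1..}) = (\<Sum>k\<in>{1..N}. F (k, t))"
      by (rule nn_integral_count_space')
        (auto simp: F order_stat_zero_beyond[where a = a and N = N, OF a(2)]
           order_stat_zero_beyond[where a = b and N = N, OF b(2)])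
    also have "\<dots> = ennreal (\<Sum>i<N. \<bar>order_stat a (Suc i) - order_stat b (Suc i)\<bar> powr r)"
      by (simp add: sum.atLeast1_atMost_eq F)
    also have "\<dots> \<le> ennreal (\<Sum>i<N. \<bar>a i - b i\<bar> powr r)"
      by (intro ennreal_leI sum_order_stat_le[OF convex_on_abs_powr[OF r]] a b)
    also have "\<dots> = (\<Sum>i<N. ennpowr (ennreal \<bar>a i - b i\<bar>) r)"
      by (simp add: ennpowr_ennreal)
    finally show ?thesis by (simp add: a_def b_def)
  qed
  have "(\<integral>\<^sup>+ x. F x \<partial>landscape_measure) = (\<integral>\<^sup>+ t. \<integral>\<^sup>+ k. F (k, t) \<partial>count_space {1..} \<partial>lborel)"
    unfolding landscape_measure_def
    by (rule nn_integral_snd[symmetric]) (rule m[unfolded landscape_measure_def])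
  also have "\<dots> \<le> (\<integral>\<^sup>+ t. (\<Sum>i<N. ennpowr (ennreal \<bar>triangle (I i) t - triangle (J i) t\<bar>) r) \<partial>lborel)"
    by (intro nn_integral_mono pt)
  also have "\<dots> = (\<Sum>i<N. \<integral>\<^sup>+ t. ennpowr (ennreal \<bar>triangle (I i) t - triangle (J i) t\<bar>) r \<partial>lborel)"
    by (intro nn_integral_sum) measurable
  finally show ?thesis by (simp add: F_def)
qed

text \<open>Reordering the second listing along the matching does not change its landscape, so the identity
  matching is enough.\<close>

lemma landscape_matching_le:
  assumes p: "1 \<le> p"
    and I: "\<And>i. I i \<in> Int_bco" "\<And>i. i \<ge> N \<Longrightarrow> I i = {}"
    and J: "\<And>i. J i \<in> Int_bco" "\<And>i. i \<ge> N \<Longrightarrow> J i = {}"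
    and s: "s permutes {..<N}"
  shows "Lp_norm p landscape_measure (\<lambda>x. ennreal \<bar>seq_landscape I x - seq_landscape J x\<bar>)
    \<le> Lp_norm p (count_space {..<N}) (\<lambda>i. bar_dist p (I i) (J (s i)))"
proof -
  define J' where "J' = J \<circ> s"
  have J': "J' i \<in> Int_bco" "i \<ge> N \<Longrightarrow> J' i = {}" for i
    using J s by (auto simp: J'_def permutes_not_in)
  have "order_stat (\<lambda>i. triangle (J (s i)) t) k = order_stat (\<lambda>i. triangle (J i) t) k" for t k
    by (rule order_stat_comp_bij[OF permutes_bij[OF s], of "\<lambda>i. triangle (J i) t"])
  then have "seq_landscape J' = seq_landscape J"
    by (auto simp: seq_landscape_def J'_def)
  moreover have "Lp_norm p landscape_measure (\<lambda>x. ennreal \<bar>seq_landscape I x - seq_landscape J' x\<bar>)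
    \<le> Lp_norm p (count_space {..<N}) (\<lambda>i. bar_dist p (I i) (J' i))"
  proof (cases "p = \<infinity>")
    case True
    then show ?thesis
      using landscape_matching_le_top[OF I J'] by (simp add: Lp_norm_def)
  next
    case False
    show ?thesis
      unfolding Lp_norm_le_iff[OF p False] ennpowr_Lp_norm[OF p False] nn_integral_count_space_finite[OF finite_lessThan]
      using landscape_matching_le_powr[OF one_le_enn2real[OF p False] I J']
      by (simp add: bar_dist_def ennpowr_Lp_norm[OF p False])
  qed
  ultimately show ?thesis by (simp add: J'_def)
qed

lemma landscape_le_finite_wasserstein:
  assumes p: "1 \<le> p" and Is: "set Is \<subseteq> Int_bco" and Js: "set Js \<subseteq> Int_bco"
  shows "Lp_norm p landscape_measure (\<lambda>x. ennreal \<bar>seq_landscape (padded Is) x - seq_landscape (padded Js) x\<bar>)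
    \<le> finite_wasserstein p Is Js"
  unfolding finite_wasserstein_def
proof (rule Min.boundedI)
  have pad: "padded Ks i \<in> Int_bco" if "set Ks \<subseteq> Int_bco" for Ks i
    using that by (auto simp: padded_def)
  fix c assume "c \<in> (\<lambda>\<sigma>. Lp_norm p (count_space {..<length Is + length Js})
                 (\<lambda>i. bar_dist p (padded Is i) (padded Js (\<sigma> i)))) ` {\<sigma>. \<sigma> permutes {..<length Is + length Js}}"
  then obtain s where s: "s permutes {..<length Is + length Js}"
    and c: "c = Lp_norm p (count_space {..<length Is + length Js}) (\<lambda>i. bar_dist p (padded Is i) (padded Js (s i)))"
    by blast
  show "Lp_norm p landscape_measure (\<lambda>x. ennreal \<bar>seq_landscape (padded Is) x - seq_landscape (padded Js) x\<bar>) \<le> c"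
    unfolding c by (rule landscape_matching_le[OF p _ _ _ _ s]) (auto simp: pad Is Js, auto simp: padded_def)
qed (auto simp: finite_permutations intro: exI[of _ id] permutes_id)

section \<open>Convergence of the distances of truncations\<close>

lemma finite_wasserstein_attained:
  obtains s where "s permutes {..<length Is + length Js}"
    "finite_wasserstein p Is Js = Lp_norm p (count_space {..<length Is + length Js})
       (\<lambda>i. bar_dist p (padded Is i) (padded Js (s i)))"
proof -
  have "finite_wasserstein p Is Js \<in> (\<lambda>\<sigma>. Lp_norm p (count_space {..<length Is + length Js})
                 (\<lambda>i. bar_dist p (padded Is i) (padded Js (\<sigma> i)))) ` {\<sigma>. \<sigma> permutes {..<length Is + length Js}}"
    unfolding finite_wasserstein_def
    by (rule Min_in) (auto simp: finite_permutations intro: exI[of _ id] permutes_id)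
  then show ?thesis using that by blast
qed

lemma finite_wasserstein_le:
  assumes "s permutes {..<length Is + length Js}"
  shows "finite_wasserstein p Is Js \<le> Lp_norm p (count_space {..<length Is + length Js})
       (\<lambda>i. bar_dist p (padded Is i) (padded Js (s i)))"
  unfolding finite_wasserstein_def
  using assms by (intro Min_le) (auto simp: finite_permutations)

definition initial :: "(nat \<Rightarrow> real set) \<Rightarrow> nat \<Rightarrow> real set list" where
  "initial I n = map I [0..<n]"

lemma length_initial [simp]: "length (initial I n) = n"
  by (simp add: initial_def)

lemma padded_initial: "padded (initial I n) i = (if i < n then I i else {})"
  by (simp add: padded_def initial_def)

lemma bar_dist_commute: "bar_dist p I J = bar_dist p J I"
  by (simp add: bar_dist_def abs_minus_commute)

text \<open>At level \<open>n\<close> the positions \<open>n, \<dots>, 2n - 1\<close> hold blanks, whereas at level \<open>n + 1\<close> the new bars sit at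
  position \<open>n\<close>.  The reindexing \<open>\<rho>\<close> moves the new bar of \<open>I\<close> to position \<open>2n\<close>, and a similar swap moves
  that of \<open>J\<close> to \<open>2n + 1\<close>; the old matching then acts on the first \<open>2n\<close> positions, and each new bar is
  matched with a blank.\<close>

lemma extend_matching:
  assumes s: "s permutes {..<n + n}"
  obtains \<rho> \<tau> where "\<rho> permutes {..<Suc n + Suc n}" "\<tau> permutes {..<Suc n + Suc n}"
    "\<And>i. i < n + n \<Longrightarrow> padded (initial I (Suc n)) (\<rho> i) = padded (initial I n) i"
    "\<And>i. i < n + n \<Longrightarrow> padded (initial J (Suc n)) (\<tau> (\<rho> i)) = padded (initial J n) (s i)"
    "padded (initial I (Suc n)) (\<rho> (n + n)) = I n" "padded (initial J (Suc n)) (\<tau> (\<rho> (n + n))) = {}"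
    "padded (initial I (Suc n)) (\<rho> (Suc (n + n))) = {}" "padded (initial J (Suc n)) (\<tau> (\<rho> (Suc (n + n)))) = J n"
proof -
  define \<rho> where "\<rho> = Transposition.transpose n (n + n)"
  define \<rho>' where "\<rho>' = Transposition.transpose n (Suc (n + n))"
  define \<tau> where "\<tau> = \<rho>' \<circ> s \<circ> \<rho>"
  have p: "\<rho> permutes {..<Suc n + Suc n}" "\<rho>' permutes {..<Suc n + Suc n}"
    unfolding \<rho>_def \<rho>'_def by (auto intro!: permutes_swap_id)
  have "s permutes {..<Suc n + Suc n}"
    by (rule permutes_subset[OF s]) auto
  then have \<tau>: "\<tau> permutes {..<Suc n + Suc n}"
    unfolding \<tau>_def by (intro permutes_compose p)
  have s': "s (n + n) = n + n" "s (Suc (n + n)) = Suc (n + n)"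
    using permutes_not_in[OF s] by auto
  have lt: "s i < n + n" if "i < n + n" for i
    using permutes_in_image[OF s, of i] that by simp
  have \<tau>\<rho>: "\<tau> (\<rho> i) = \<rho>' (s i)" for i
    by (simp add: \<tau>_def \<rho>_def)
  have I: "padded (initial I (Suc n)) (\<rho> i) = (if i = n + n then I n else padded (initial I n) i)" for i
    by (auto simp: padded_initial \<rho>_def Transposition.transpose_def)
  have J: "padded (initial J (Suc n)) (\<rho>' i) = (if i = Suc (n + n) then J n else padded (initial J n) i)" for i
    by (auto simp: padded_initial \<rho>'_def Transposition.transpose_def)
  show ?thesis
  proof (rule that[OF p(1) \<tau>])
    fix i assume i: "i < n + n"
    show "padded (initial I (Suc n)) (\<rho> i) = padded (initial I n) i"
      using i by (simp add: I)
    show "padded (initial J (Suc n)) (\<tau> (\<rho> i)) = padded (initial J n) (s i)"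
      using lt[OF i] by (simp add: \<tau>\<rho> J)
  qed (simp_all only: \<tau>\<rho> I J s', simp_all add: padded_initial)
qed

abbreviation wass :: "ennreal \<Rightarrow> (nat \<Rightarrow> real set) \<Rightarrow> (nat \<Rightarrow> real set) \<Rightarrow> nat \<Rightarrow> ennreal" where
  "wass p I J n \<equiv> finite_wasserstein p (initial I n) (initial J n)"

lemma wass_Suc_le_top:
  "wass \<infinity> I J (Suc n) \<le> max (wass \<infinity> I J n) (max (bar_dist \<infinity> (I n) {}) (bar_dist \<infinity> (J n) {}))"
    (is "_ \<le> ?M")
proof -
  obtain s where s: "s permutes {..<n + n}"
    and W: "wass \<infinity> I J n = Lp_norm \<infinity> (count_space {..<n + n})
       (\<lambda>i. bar_dist \<infinity> (padded (initial I n) i) (padded (initial J n) (s i)))"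
    by (rule finite_wasserstein_attained[of "initial I n" "initial J n" \<infinity>]) auto
  obtain \<rho> \<tau> where e: "\<rho> permutes {..<Suc n + Suc n}" "\<tau> permutes {..<Suc n + Suc n}"
    "\<And>i. i < n + n \<Longrightarrow> padded (initial I (Suc n)) (\<rho> i) = padded (initial I n) i"
    "\<And>i. i < n + n \<Longrightarrow> padded (initial J (Suc n)) (\<tau> (\<rho> i)) = padded (initial J n) (s i)"
    "padded (initial I (Suc n)) (\<rho> (n + n)) = I n" "padded (initial J (Suc n)) (\<tau> (\<rho> (n + n))) = {}"
    "padded (initial I (Suc n)) (\<rho> (Suc (n + n))) = {}" "padded (initial J (Suc n)) (\<tau> (\<rho> (Suc (n + n)))) = J n"
    using extend_matching[OF s, where I = I and J = J] by blast
  have Wi: "bar_dist \<infinity> (padded (initial I n) i) (padded (initial J n) (s i)) \<le> wass \<infinity> I J n" if "i < n + n" for i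
    using esssup_AE[of "\<lambda>i. bar_dist \<infinity> (padded (initial I n) i) (padded (initial J n) (s i))" "count_space {..<n + n}"] that
    unfolding W by (simp add: Lp_norm_def AE_count_space)
  have *: "bar_dist \<infinity> (padded (initial I (Suc n)) (\<rho> i)) (padded (initial J (Suc n)) (\<tau> (\<rho> i))) \<le> ?M"
    if i: "i < Suc n + Suc n" for i
  proof -
    consider "i < n + n" | "i = n + n" | "i = Suc (n + n)" using i by linarith
    then show ?thesis
    proof cases
      case 1
      then show ?thesis using Wi[OF 1] e(3)[OF 1] e(4)[OF 1] by (simp add: le_max_iff_disj)
    next
      case 2
      then show ?thesis using e(5,6) by (simp add: le_max_iff_disj)
    next
      case 3
      then show ?thesis using e(7,8) by (simp add: le_max_iff_disj bar_dist_commute[of _ "{}"])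
    qed
  qed
  have "bar_dist \<infinity> (padded (initial I (Suc n)) i) (padded (initial J (Suc n)) (\<tau> i)) \<le> ?M"
    if "i < Suc n + Suc n" for i
  proof -
    have "inv \<rho> i < Suc n + Suc n"
      using permutes_in_image[OF permutes_inv[OF e(1)], of i] that by simp
    from *[OF this] show ?thesis by (simp only: permutes_inverses(1)[OF e(1)])
  qed
  then have "esssup (count_space {..<Suc n + Suc n}) (\<lambda>i. bar_dist \<infinity> (padded (initial I (Suc n)) i) (padded (initial J (Suc n)) (\<tau> i))) \<le> ?M"
    by (intro esssup_I) (auto simp: AE_count_space)
  with finite_wasserstein_le[of \<tau> "initial I (Suc n)" "initial J (Suc n)" \<infinity>] e(2)
  show ?thesis by (simp add: Lp_norm_def)
qed

lemma wass_Suc_le_powr: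
  assumes p: "1 \<le> p" "p \<noteq> \<infinity>"
  defines "r \<equiv> enn2real p"
  shows "ennpowr (wass p I J (Suc n)) r
     \<le> ennpowr (wass p I J n) r + (ennpowr (bar_dist p (I n) {}) r + ennpowr (bar_dist p (J n) {}) r)"
proof -
  obtain s where s: "s permutes {..<n + n}"
    and W: "wass p I J n = Lp_norm p (count_space {..<n + n})
       (\<lambda>i. bar_dist p (padded (initial I n) i) (padded (initial J n) (s i)))"
    by (rule finite_wasserstein_attained[of "initial I n" "initial J n" p]) auto
  obtain \<rho> \<tau> where e: "\<rho> permutes {..<Suc n + Suc n}" "\<tau> permutes {..<Suc n + Suc n}"
    "\<And>i. i < n + n \<Longrightarrow> padded (initial I (Suc n)) (\<rho> i) = padded (initial I n) i"
    "\<And>i. i < n + n \<Longrightarrow> padded (initial J (Suc n)) (\<tau> (\<rho> i)) = padded (initial J n) (s i)"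
    "padded (initial I (Suc n)) (\<rho> (n + n)) = I n" "padded (initial J (Suc n)) (\<tau> (\<rho> (n + n))) = {}"
    "padded (initial I (Suc n)) (\<rho> (Suc (n + n))) = {}" "padded (initial J (Suc n)) (\<tau> (\<rho> (Suc (n + n)))) = J n"
    using extend_matching[OF s, where I = I and J = J] by blast
  define D where "D K L = ennpowr (bar_dist p K L) r" for K L
  have "ennpowr (wass p I J (Suc n)) r \<le> ennpowr (Lp_norm p (count_space {..<Suc n + Suc n})
     (\<lambda>i. bar_dist p (padded (initial I (Suc n)) i) (padded (initial J (Suc n)) (\<tau> i)))) r"
    using finite_wasserstein_le[of \<tau> "initial I (Suc n)" "initial J (Suc n)" p] e(2)
    by (intro ennpowr_mono) (auto simp: r_def)
  also have "\<dots> = (\<Sum>i<Suc n + Suc n. D (padded (initial I (Suc n)) i) (padded (initial J (Suc n)) (\<tau> i)))"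
    unfolding r_def ennpowr_Lp_norm[OF p] D_def by (simp add: nn_integral_count_space_finite)
  also have "\<dots> = (\<Sum>i<Suc n + Suc n. D (padded (initial I (Suc n)) (\<rho> i)) (padded (initial J (Suc n)) (\<tau> (\<rho> i))))"
    by (subst sum.permute[OF e(1)]) (simp add: o_def)
  also have "\<dots> = (\<Sum>i<n + n. D (padded (initial I n) i) (padded (initial J n) (s i))) + D (I n) {} + D {} (J n)"
  proof -
    have split: "(\<Sum>i<Suc n + Suc n. F i) = (\<Sum>i<n + n. F i) + F (n + n) + F (Suc (n + n))" for F :: "nat \<Rightarrow> ennreal"
      by simp
    show ?thesis unfolding split e(5-8) by (simp add: e(3,4))
  qed
  also have "(\<Sum>i<n + n. D (padded (initial I n) i) (padded (initial J n) (s i))) = ennpowr (wass p I J n) r"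
    unfolding W r_def ennpowr_Lp_norm[OF p] D_def by (simp add: nn_integral_count_space_finite)
  finally show ?thesis by (simp add: D_def add.assoc bar_dist_commute[of _ "{}"])
qed

text \<open>The condition on a listing in the definition of \<open>p\<close>-finiteness, demanded of finite and infinite
  barcodes alike; listings of finite barcodes satisfy it.\<close>

definition p_summable :: "ennreal \<Rightarrow> (nat \<Rightarrow> real set) \<Rightarrow> bool" where
  "p_summable p I \<longleftrightarrow>
     (if p = \<infinity> then (\<lambda>i. bar_dist p (I i) {}) \<longlonglongrightarrow> 0
      else Lp_norm p (count_space UNIV) (\<lambda>i. bar_dist p (I i) {}) < \<infinity>)"

text \<open>The hypothesis gives \<open>limsup u \<le> u n + e n\<close> for every \<open>n\<close>, hence \<open>limsup u \<le> liminf u\<close>.\<close>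

lemma tendsto_of_almost_decreasing:
  fixes u e :: "nat \<Rightarrow> ennreal"
  assumes le: "\<And>n m. n \<le> m \<Longrightarrow> u m \<le> u n + e n" and e: "e \<longlonglongrightarrow> 0"
  shows "u \<longlonglongrightarrow> liminf u"
proof -
  have "limsup u \<le> liminf u"
  proof (rule ennreal_le_epsilon)
    fix d :: real assume d: "0 < d"
    have "\<forall>\<^sub>F n in sequentially. e n < ennreal d"
      using e d by (intro order_tendstoD) auto
    then have "\<forall>\<^sub>F n in sequentially. limsup u - ennreal d \<le> u n"
    proof eventually_elim
      case (elim n)
      have "limsup u \<le> u n + e n"
        using le by (intro Limsup_bounded eventually_sequentiallyI[of n])
      also have "\<dots> \<le> ennreal d + u n"
        using elim by (simp add: add.commute add_left_mono less_imp_le)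
      finally show ?case by (simp only: ennreal_minus_le_iff) simp
    qed
    then have "limsup u - ennreal d \<le> liminf u" by (rule Liminf_bounded)
    then show "limsup u \<le> liminf u + ennreal d"
      by (simp only: ennreal_minus_le_iff add.commute[of "ennreal d"])
  qed
  then show ?thesis
    using Liminf_le_Limsup[of sequentially u] by (simp add: tendsto_iff_Liminf_eq_Limsup)
qed

lemma wass_0: "1 \<le> p \<Longrightarrow> wass p I J 0 = 0"
proof -
  assume p: "1 \<le> p"
  have "wass p I J 0 \<le> Lp_norm p (count_space {}) (\<lambda>i. bar_dist p (padded (initial I 0) i) (padded (initial J 0) (id i)))"
    using finite_wasserstein_le[of id "initial I 0" "initial J 0" p] by (simp add: permutes_id)
  also have "\<dots> \<le> 0"
  proof (cases "p = \<infinity>")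
    case True
    have "esssup (count_space {}) (\<lambda>i. bar_dist p (padded (initial I 0) i) (padded (initial J 0) (id i))) \<le> 0"
      by (rule esssup_I) (auto simp: AE_count_space)
    then show ?thesis using True by (simp add: Lp_norm_def)
  next
    case False
    then show ?thesis unfolding Lp_norm_le_iff[OF p False] by (simp add: nn_integral_count_space_finite)
  qed
  finally show ?thesis by simp
qed

text \<open>The error of passing from level \<open>n\<close> to any later level is at most the supremum of the remaining
  heights, which tends to \<open>0\<close>.\<close>

lemma wass_convergent_top:
  assumes "(\<lambda>i. bar_dist \<infinity> (I i) {}) \<longlonglongrightarrow> 0" "(\<lambda>i. bar_dist \<infinity> (J i) {}) \<longlonglongrightarrow> 0"
    and fin: "\<And>i. bar_dist \<infinity> (I i) {} < top" "\<And>i. bar_dist \<infinity> (J i) {} < top"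
  shows "\<exists>L<top. wass \<infinity> I J \<longlonglongrightarrow> L"
proof -
  define c where "c n = max (bar_dist \<infinity> (I n) {}) (bar_dist \<infinity> (J n) {})" for n
  have c: "c \<longlonglongrightarrow> 0"
    using tendsto_max[OF assms(1,2)] by (simp add: c_def[abs_def])
  have cf: "c n < top" for n using fin by (simp add: c_def)
  define e where "e n = (SUP i\<in>{n..}. c i)" for n
  have "decseq e" unfolding e_def by (intro antimonoI SUP_subset_mono) auto
  then have "e \<longlonglongrightarrow> (INF n. e n)" by (rule LIMSEQ_INF)
  moreover have "(INF n. e n) = 0"
    using lim_imp_Limsup[OF _ c] by (simp add: limsup_INF_SUP e_def)
  ultimately have e: "e \<longlonglongrightarrow> 0" by simp
  have wstep: "wass \<infinity> I J (Suc n) \<le> max (wass \<infinity> I J n) (c n)" for n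
    using wass_Suc_le_top[of I n J] by (simp add: c_def)
  have le: "wass \<infinity> I J m \<le> wass \<infinity> I J n + e n" if "n \<le> m" for n m
    using that
  proof (induction m rule: dec_induct)
    case (step m)
    have "c m \<le> e n" unfolding e_def using step by (intro SUP_upper) auto
    also have "e n \<le> wass \<infinity> I J n + e n" by simp
    finally have "max (wass \<infinity> I J m) (c m) \<le> wass \<infinity> I J n + e n"
      using step.IH by simp
    with wstep[of m] show ?case by (rule order_trans)
  qed simp
  have fW: "wass \<infinity> I J n < top" for n
  proof (induction n)
    case (Suc n)
    then show ?case using wstep[of n] cf[of n] by (auto intro: order_le_less_trans)
  qed (simp add: wass_0)
  have lim: "wass \<infinity> I J \<longlonglongrightarrow> liminf (wass \<infinity> I J)"
    using le e by (rule tendsto_of_almost_decreasing)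
  obtain N where N: "e N < top"
    using order_tendstoD(2)[OF e, of top] by (auto simp: eventually_sequentially)
  have "liminf (wass \<infinity> I J) \<le> wass \<infinity> I J N + e N"
    using le by (intro LIMSEQ_le_const2[OF lim]) auto
  also have "\<dots> < top" using N fW[of N] by simp
  finally show ?thesis using lim by blast
qed

text \<open>The \<open>p\<close>th powers of the distances increase by at most the terms of a convergent series.  After
  subtracting its partial sums they form a decreasing sequence that is bounded below.\<close>

lemma wass_convergent_powr:
  assumes p: "1 \<le> p" "p \<noteq> \<infinity>"
    and fin: "Lp_norm p (count_space UNIV) (\<lambda>i. bar_dist p (I i) {}) < top"
      "Lp_norm p (count_space UNIV) (\<lambda>i. bar_dist p (J i) {}) < top"
  shows "\<exists>L<top. wass p I J \<longlonglongrightarrow> L"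
proof -
  define r where "r = enn2real p"
  have r: "1 \<le> r" using one_le_enn2real[OF p] by (simp add: r_def)
  define c where "c n = ennpowr (bar_dist p (I n) {}) r + ennpowr (bar_dist p (J n) {}) r" for n
  have "(\<Sum>n. ennpowr (bar_dist p (K n) {}) r) < top"
    if "Lp_norm p (count_space UNIV) (\<lambda>i. bar_dist p (K i) {}) < top" for K :: "nat \<Rightarrow> real set"
    using that ennpowr_less_top_iff[of "Lp_norm p (count_space UNIV) (\<lambda>i. bar_dist p (K i) {})" r]
    by (simp add: r_def ennpowr_Lp_norm[OF p] nn_integral_count_space_nat)
  from this[OF fin(1)] this[OF fin(2)] have S: "(\<Sum>n. c n) < top"
    unfolding c_def by (subst suminf_add[symmetric]) auto
  define v where "v n = enn2real (ennpowr (wass p I J n) r)" for n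
  define x where "x n = enn2real (c n)" for n
  have cf: "c n < top" for n
    using S sum_le_suminf[of c "{n}"] by (auto intro: order_le_less_trans)
  have sumc: "(\<Sum>i<n. c i) \<le> (\<Sum>n. c n)" for n
    by (rule sum_le_suminf) auto
  have xs: "(\<Sum>i<n. x i) \<le> enn2real (\<Sum>n. c n)" for n
  proof -
    have "ennreal (\<Sum>i<n. x i) = (\<Sum>i<n. c i)"
      using cf by (simp add: x_def flip: sum_ennreal)
    with sumc[of n] S have "ennreal (\<Sum>i<n. x i) \<le> ennreal (enn2real (\<Sum>n. c n))" by simp
    then show ?thesis by (subst (asm) ennreal_le_iff) auto
  qed
  have step: "ennpowr (wass p I J (Suc n)) r \<le> ennpowr (wass p I J n) r + c n" for n
    using wass_Suc_le_powr[OF p, of I n J] by (simp add: c_def r_def)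
  have Vf: "ennpowr (wass p I J n) r < top" for n
  proof (induction n)
    case (Suc n)
    then show ?case using step[of n] cf[of n] by (auto intro: order_le_less_trans)
  qed (simp add: wass_0[OF p(1)])
  have vstep: "v (Suc n) \<le> v n + x n" for n
  proof -
    have "enn2real (ennpowr (wass p I J (Suc n)) r) \<le> enn2real (ennpowr (wass p I J n) r + c n)"
      using step Vf cf by (intro enn2real_mono) auto
    then show ?thesis using Vf cf by (simp add: v_def x_def enn2real_plus)
  qed
  have "summable x"
    by (rule summableI_nonneg_bounded[OF _ xs]) (simp add: x_def)
  have dec: "decseq (\<lambda>n. v n - (\<Sum>i<n. x i))"
    using vstep by (intro decseq_SucI) (simp add: algebra_simps)
  have bd: "- enn2real (\<Sum>n. c n) \<le> v n - (\<Sum>i<n. x i)" for n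
  proof -
    have "0 \<le> v n" by (simp add: v_def)
    with xs[of n] show ?thesis by linarith
  qed
  obtain w where w: "(\<lambda>n. v n - (\<Sum>i<n. x i)) \<longlonglongrightarrow> w"
    by (rule decseq_convergent[OF dec]) (use bd in blast)+
  have "v \<longlonglongrightarrow> w + (\<Sum>i. x i)"
    using tendsto_add[OF w summable_LIMSEQ[OF \<open>summable x\<close>]] by simp
  then have "(\<lambda>n. ennreal (v n)) \<longlonglongrightarrow> ennreal (w + (\<Sum>i. x i))" by (rule tendsto_ennrealI)
  moreover have "ennreal (v n) = ennpowr (wass p I J n) r" for n
    using Vf by (simp add: v_def)
  ultimately have "(\<lambda>n. ennpowr (wass p I J n) r) \<longlonglongrightarrow> ennreal (w + (\<Sum>i. x i))" by simp
  from tendsto_ennpowr[OF this, of "1 / r"] r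
  have "wass p I J \<longlonglongrightarrow> ennpowr (ennreal (w + (\<Sum>i. x i))) (1 / r)"
    by (simp add: ennpowr_ennpowr_inverse)
  moreover have "ennpowr (ennreal (w + (\<Sum>i. x i))) (1 / r) < top"
    by (simp add: ennpowr_less_top_iff)
  ultimately show ?thesis by blast
qed

lemma wass_convergent:
  assumes p: "1 \<le> p" and "range I \<subseteq> Int_bco" "range J \<subseteq> Int_bco" "p_summable p I" "p_summable p J"
  shows "\<exists>L<top. wass p I J \<longlonglongrightarrow> L"
proof (cases "p = \<infinity>")
  case True
  have "bar_dist \<infinity> (I i) {} < top" "bar_dist \<infinity> (J i) {} < top" for i
    using assms by (auto intro!: bar_dist_less_top)
  then show ?thesis
    unfolding True using assms(4,5) True
    by (intro wass_convergent_top) (auto simp: p_summable_def)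
next
  case False
  then show ?thesis
    using assms by (intro wass_convergent_powr) (auto simp: p_summable_def)
qed

section \<open>Passage to infinite barcodes\<close>

lemma p_summable_imp_vanishing_bars:
  assumes p: "1 \<le> p" and I: "range I \<subseteq> Int_bco" and s: "p_summable p I"
  shows "vanishing_bars I"
  unfolding vanishing_bars_def vanishing_def
proof (intro conjI allI impI I)
  fix t x :: real assume "0 < x"
  obtain c where c: "0 < c" "\<And>I t. I \<in> Int_bco \<Longrightarrow> x < triangle I t \<Longrightarrow> c \<le> bar_dist p I {}"
    using bar_dist_lower_bound[OF p \<open>0 < x\<close>] by blast
  define A where "A = {i. c \<le> bar_dist p (I i) {}}"
  have sub: "{i. x < triangle (I i) t} \<subseteq> A"
    using c(2)[OF range_subsetD[OF I]] by (auto simp: A_def)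
  have "finite A"
  proof (cases "p = \<infinity>")
    case True
    then have "\<forall>\<^sub>F i in sequentially. bar_dist p (I i) {} < c"
      using s c(1) by (intro order_tendstoD) (auto simp: p_summable_def)
    then obtain N where "\<And>i. i \<ge> N \<Longrightarrow> bar_dist p (I i) {} < c"
      by (auto simp: eventually_sequentially)
    then have "A \<subseteq> {..<N}" unfolding A_def by (auto simp: not_less[symmetric] simp del: not_less)
    then show ?thesis by (rule finite_subset) simp
  next
    case False
    define r where "r = enn2real p"
    have r: "1 \<le> r" using one_le_enn2real[OF p False] by (simp add: r_def)
    show ?thesis
    proof (rule ccontr)
      assume inf: "infinite A"
      have c0: "ennpowr c r > 0"
        using c(1) ennpowr_ennpowr_inverse[of r c] r by (cases "ennpowr c r = 0") (auto simp: zero_less_iff_neq_zero)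
      have "top = (\<integral>\<^sup>+ i. ennpowr c r * indicator A i \<partial>count_space UNIV)"
        using inf c0 by (simp add: nn_integral_cmult_indicator emeasure_count_space_infinite ennreal_mult_top)
      also have "\<dots> \<le> (\<integral>\<^sup>+ i. ennpowr (bar_dist p (I i) {}) r \<partial>count_space UNIV)"
        using r by (intro nn_integral_mono) (auto simp: A_def indicator_def intro!: ennpowr_mono)
      also have "\<dots> < top"
        using s False ennpowr_less_top_iff[of "Lp_norm p (count_space UNIV) (\<lambda>i. bar_dist p (I i) {})" r]
        by (simp add: p_summable_def r_def ennpowr_Lp_norm[OF p False])
      finally show False by simp
    qed
  qed
  with sub show "finite {i. x < triangle (I i) t}" by (rule finite_subset)
qed

text \<open>At a fixed \<open>t\<close>, the discarded heights are uniformly small once the finitely many bars with large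
  height at \<open>t\<close> are included, and sorting is uniformly stable.\<close>

lemma seq_landscape_initial_tendsto:
  assumes I: "vanishing_bars I" and k: "1 \<le> k"
  shows "(\<lambda>n. seq_landscape (padded (initial I n)) (k, t)) \<longlonglongrightarrow> seq_landscape I (k, t)"
proof (rule LIMSEQ_I)
  fix e :: real assume e: "0 < e"
  have "finite {i. e / 2 < triangle (I i) t}"
    using vanishingD[OF vanishing_barsD(2)[OF I], of "e / 2" t] e by simp
  then obtain N where N: "\<And>i. e / 2 < triangle (I i) t \<Longrightarrow> i < N"
    using finite_nat_bounded by blast
  have "norm (seq_landscape (padded (initial I n)) (k, t) - seq_landscape I (k, t)) < e" if n: "N \<le> n" for n
  proof -
    have "\<bar>seq_landscape (padded (initial I n)) (k, t) - seq_landscape I (k, t)\<bar> \<le> e / 2"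
      unfolding seq_landscape_def prod.case
    proof (rule order_stat_stable[OF _ vanishing_barsD(2)[OF I] k])
      show "vanishing (\<lambda>i. triangle (padded (initial I n) i) t)"
        by (rule vanishing_finite_support[of n]) (simp add: padded_initial)
      fix i
      have "triangle (I i) t \<le> e / 2" if "\<not> i < n"
        using N[of i] that n by fastforce
      then show "\<bar>triangle (padded (initial I n) i) t - triangle (I i) t\<bar> \<le> e / 2"
        using triangle_nonneg[OF vanishing_barsD(1)[OF I], of i t] e by (auto simp: padded_initial)
    qed
    then show ?thesis using e by simp
  qed
  then show "\<exists>N. \<forall>n\<ge>N. norm (seq_landscape (padded (initial I n)) (k, t) - seq_landscape I (k, t)) < e"
    by blast
qed

text \<open>Fatou's lemma along the truncations; for \<open>p = \<infinity>\<close>, the almost everywhere bounds for countably many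
  truncations hold simultaneously.\<close>

lemma seq_landscape_dist_le:
  assumes p: "1 \<le> p" and I: "range I \<subseteq> Int_bco" "p_summable p I"
    and J: "range J \<subseteq> Int_bco" "p_summable p J"
    and L: "wass p I J \<longlonglongrightarrow> L" "L < top"
  shows "Lp_norm p landscape_measure (\<lambda>x. ennreal \<bar>seq_landscape I x - seq_landscape J x\<bar>) \<le> L"
proof -
  define f where "f n x = ennreal \<bar>seq_landscape (padded (initial I n)) x - seq_landscape (padded (initial J n)) x\<bar>" for n x
  define g where "g x = ennreal \<bar>seq_landscape I x - seq_landscape J x\<bar>" for x
  note v = p_summable_imp_vanishing_bars[OF p I] p_summable_imp_vanishing_bars[OF p J]
  have pv: "vanishing_bars (padded (initial K n))" if "range K \<subseteq> Int_bco" for K n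
    using that by (intro vanishing_bars_finite_support[of _ n]) (auto simp: padded_initial)
  have fm[measurable]: "f n \<in> borel_measurable landscape_measure" for n
    using pv[OF I(1), of n] pv[OF J(1), of n] unfolding f_def by measurable
  have gm[measurable]: "g \<in> borel_measurable landscape_measure"
    using v unfolding g_def by measurable
  have le: "Lp_norm p landscape_measure (f n) \<le> wass p I J n" for n
    unfolding f_def using I(1) J(1) by (intro landscape_le_finite_wasserstein p) (auto simp: initial_def)
  have lim: "(\<lambda>n. f n x) \<longlonglongrightarrow> g x" if "x \<in> space landscape_measure" for x
  proof -
    obtain k t where x: "x = (k, t)" by (cases x)
    have k: "1 \<le> k" using that by (simp add: x landscape_measure_def space_pair_measure)
    show ?thesis
      unfolding f_def g_def x
      by (intro tendsto_ennrealI tendsto_intros seq_landscape_initial_tendsto v k)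
  qed
  have "Lp_norm p landscape_measure g \<le> L"
  proof (cases "p = \<infinity>")
    case True
    have "AE x in landscape_measure. f n x \<le> wass p I J n" for n
    proof (rule AE_mp[OF esssup_AE[of "f n"]], intro AE_I2 impI)
      fix x assume "f n x \<le> esssup landscape_measure (f n)"
      also have "\<dots> \<le> wass p I J n" using le[of n] True by (simp add: Lp_norm_def)
      finally show "f n x \<le> wass p I J n" .
    qed
    then have "AE x in landscape_measure. \<forall>n. f n x \<le> wass p I J n"
      by (simp add: AE_all_countable)
    then have "AE x in landscape_measure. g x \<le> L"
    proof (rule AE_mp, intro AE_I2 impI)
      fix x assume "x \<in> space landscape_measure" "\<forall>n. f n x \<le> wass p I J n"
      then show "g x \<le> L" by (intro LIMSEQ_le[OF lim L(1)]) auto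
    qed
    then show ?thesis using True by (simp add: Lp_norm_def esssup_I)
  next
    case False
    define r where "r = enn2real p"
    have r: "1 \<le> r" using one_le_enn2real[OF p False] by (simp add: r_def)
    have "(\<integral>\<^sup>+ x. ennpowr (g x) r \<partial>landscape_measure)
        = (\<integral>\<^sup>+ x. liminf (\<lambda>n. ennpowr (f n x) r) \<partial>landscape_measure)"
    proof (rule nn_integral_cong)
      fix x assume "x \<in> space landscape_measure"
      then have "(\<lambda>n. ennpowr (f n x) r) \<longlonglongrightarrow> ennpowr (g x) r"
        using r by (intro tendsto_ennpowr lim) (auto simp: g_def)
      then show "ennpowr (g x) r = liminf (\<lambda>n. ennpowr (f n x) r)"
        by (simp add: lim_imp_Liminf)
    qed
    also have "\<dots> \<le> liminf (\<lambda>n. \<integral>\<^sup>+ x. ennpowr (f n x) r \<partial>landscape_measure)"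
      by (intro nn_integral_liminf) measurable
    also have "\<dots> \<le> liminf (\<lambda>n. ennpowr (wass p I J n) r)"
      using le by (intro Liminf_mono always_eventually) (simp add: r_def Lp_norm_le_iff[OF p False])
    also have "\<dots> = ennpowr L r"
      using r by (intro lim_imp_Liminf tendsto_ennpowr L) auto
    finally show ?thesis by (simp add: Lp_norm_le_iff[OF p False] r_def)
  qed
  then show ?thesis by (simp add: g_def[abs_def])
qed

section \<open>The landscape of a barcode as order statistics\<close>

lemma kth_largest_eqI:
  assumes "x \<in> a ` A" "finite {i\<in>A. x < a i}" "card {i\<in>A. x < a i} < k"
    and "finite {i\<in>A. x \<le> a i} \<Longrightarrow> k \<le> card {i\<in>A. x \<le> a i}"
  shows "kth_largest A a k = x"
  unfolding kth_largest_def
proof (rule the_equality)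
  fix y
  assume y: "y \<in> a ` A \<and> finite {i \<in> A. y < a i} \<and> card {i \<in> A. y < a i} < k \<and>
    (finite {i \<in> A. y \<le> a i} \<longrightarrow> k \<le> card {i \<in> A. y \<le> a i})"
  have *: False
    if "u < v" and u: "finite {i\<in>A. u < a i}" "card {i\<in>A. u < a i} < k"
      and v: "finite {i\<in>A. v \<le> a i} \<Longrightarrow> k \<le> card {i\<in>A. v \<le> a i}" for u v
  proof -
    have sub: "{i\<in>A. v \<le> a i} \<subseteq> {i\<in>A. u < a i}" using \<open>u < v\<close> by auto
    have "k \<le> card {i\<in>A. v \<le> a i}" by (rule v) (rule finite_subset[OF sub u(1)])
    also have "\<dots> \<le> card {i\<in>A. u < a i}" by (rule card_mono[OF u(1) sub])
    finally show False using u(2) by simp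
  qed
  show "y = x"
    using *[of x y] *[of y x] y assms(2-4) by (cases x y rule: linorder_cases) auto
qed (use assms in auto)

text \<open>Half the smallest of the \<open>k\<close> positive terms is a level that at least \<open>k\<close> terms exceed.\<close>

lemma order_stat_pos:
  assumes a: "vanishing a" and k: "1 \<le> k" and F: "finite F" "k \<le> card F" "\<And>i. i \<in> F \<Longrightarrow> 0 < a i"
  shows "0 < order_stat a k"
proof -
  have ne: "F \<noteq> {}" using F(2) k by auto
  define x where "x = Min (a ` F) / 2"
  have m: "0 < Min (a ` F)" using F ne by simp
  have x: "0 < x" using m by (simp add: x_def)
  have "x < a i" if "i \<in> F" for i
  proof -
    have "Min (a ` F) \<le> a i" using F(1) that by simp
    with m show ?thesis by (simp add: x_def)
  qed
  then have "F \<subseteq> {i. x < a i}" by auto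
  then have "card F \<le> card {i. x < a i}" by (rule card_mono[OF vanishingD[OF a x]])
  then have "k \<le> card {i. x < a i}" using F(2) by (rule order_trans[rotated])
  then have "x < order_stat a k" by (rule less_order_stat_iff[OF a k x, THEN iffD2])
  with x show ?thesis by (rule less_trans)
qed

text \<open>A positive order statistic is attained: just below it at least \<open>k\<close> terms are found, above it fewer.
  The index set need only contain the positive terms, which covers all the cases in which the \<open>k\<close>th
  largest term of a landscape is positive.\<close>

lemma kth_largest_eq_order_stat:
  assumes a: "vanishing a" and nn: "\<And>i. 0 \<le> a i" and k: "1 \<le> k"
    and pos: "0 < order_stat a k" and A: "\<And>i. 0 < a i \<Longrightarrow> i \<in> A"
  shows "kth_largest A (\<lambda>i. ennreal (a i)) k = ennreal (order_stat a k)"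
proof -
  define y where "y = order_stat a k"
  have y: "0 < y" using pos by (simp add: y_def)
  have less: "ennreal y < ennreal (a i) \<longleftrightarrow> y < a i" for i
    using y by (simp add: ennreal_less_iff)
  have le: "ennreal y \<le> ennreal (a i) \<longleftrightarrow> y \<le> a i" for i
    using nn[of i] by (simp add: ennreal_le_iff)
  have eq1: "{i\<in>A. y < a i} = {i. y < a i}"
    using A y by (auto intro: less_trans)
  have eq2: "{i\<in>A. y \<le> a i} = {i. y \<le> a i}"
    using A y by (auto intro: less_le_trans)
  have fin1: "finite {i. y < a i}" by (rule vanishingD[OF a y])
  have card1: "card {i. y < a i} < k"
    using less_order_stat_iff[OF a k y] by (simp add: y_def)
  define F where "F = {i. y / 2 < a i \<and> a i < y}"
  have finF: "finite F"
    unfolding F_def using vanishingD[OF a, of "y / 2"] y by simp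
  (* A level below y with no term strictly between it and y; the value y / 2 keeps it positive. *)
  define x where "x = Max (insert (y / 2) (a ` F))"
  have xy: "x < y" unfolding x_def using finF y by (subst Max_less_iff) (auto simp: F_def)
  have x0: "0 < x" unfolding x_def using finF y by (subst Max_gr_iff) auto
  have "{i. x < a i} \<subseteq> {i. y \<le> a i}"
  proof (intro subsetI CollectI, rule ccontr)
    fix i assume i: "i \<in> {i. x < a i}" "\<not> y \<le> a i"
    have "y / 2 \<le> x" unfolding x_def using finF by (intro Max_ge) auto
    then have "i \<in> F" using i by (auto simp: F_def)
    then have "a i \<le> x" unfolding x_def using finF by (intro Max_ge) auto
    with i show False by simp
  qed
  moreover have fin2: "finite {i. y \<le> a i}"
  proof (rule finite_subset)
    show "{i. y \<le> a i} \<subseteq> {i. y / 2 < a i}" using y by auto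
    show "finite {i. y / 2 < a i}" using vanishingD[OF a, of "y / 2"] y by simp
  qed
  moreover have "k \<le> card {i. x < a i}"
    using less_order_stat_iff[OF a k x0] xy by (simp add: y_def)
  ultimately have card2: "k \<le> card {i. y \<le> a i}"
    using card_mono[of "{i. y \<le> a i}" "{i. x < a i}"] by linarith
  have "{i. y < a i} \<noteq> {i. y \<le> a i}" using card1 card2 by auto
  then obtain i where "(y < a i) \<noteq> (y \<le> a i)" by blast
  then have "a i = y" by auto
  then have mem: "ennreal y \<in> (\<lambda>i. ennreal (a i)) ` A"
    using A[of i] y by auto
  show ?thesis
    unfolding y_def[symmetric]
    by (rule kth_largest_eqI) (simp_all only: mem less le eq1 eq2 fin1 card1 card2)
qed

lemma vanishing_tendsto_0:
  assumes a: "vanishing a" and nn: "\<And>i. 0 \<le> a i"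
  shows "a \<longlonglongrightarrow> 0"
proof (rule LIMSEQ_I)
  fix e :: real assume e: "0 < e"
  have "finite {i. e / 2 < a i}" using vanishingD[OF a, of "e / 2"] e by simp
  then obtain N where N: "\<And>i. e / 2 < a i \<Longrightarrow> i < N"
    using finite_nat_bounded by blast
  have "norm (a n - 0) < e" if "N \<le> n" for n
    using N[of n] that nn[of n] e by fastforce
  then show "\<exists>N. \<forall>n\<ge>N. norm (a n - 0) < e" by blast
qed

lemma kmax_fin_eq_order_stat:
  assumes nn: "\<And>i. 0 \<le> a i" and z: "\<And>i. i \<ge> N \<Longrightarrow> a i = 0" and k: "1 \<le> k"
  shows "kmax_fin N (\<lambda>i. ennreal (a i)) k = ennreal (order_stat a k)"
proof (cases "k \<le> N")
  case False
  then show ?thesis using order_stat_zero_beyond[of N a k] z by (simp add: kmax_fin_def)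
next
  case True
  have a: "vanishing a" using z by (rule vanishing_finite_support)
  have A: "i \<in> {..<N}" if "0 < a i" for i using z[of i] that by fastforce
  show ?thesis
  proof (cases "0 < order_stat a k")
    case True
    then show ?thesis
      using kth_largest_eq_order_stat[OF a nn k True A] \<open>k \<le> N\<close> by (simp add: kmax_fin_def)
  next
    case False
    then have 0: "order_stat a k = 0" using order_stat_nonneg[OF a k] by simp
    have card: "card {i\<in>{..<N}. 0 < a i} < k"
    proof (rule ccontr)
      assume "\<not> card {i\<in>{..<N}. 0 < a i} < k"
      then have "0 < order_stat a k"
        by (intro order_stat_pos[OF a k, of "{i\<in>{..<N}. 0 < a i}"]) auto
      with False show False by simp
    qed
    have "{i\<in>{..<N}. 0 < a i} \<noteq> {..<N}"
    proof
      assume "{i\<in>{..<N}. 0 < a i} = {..<N}"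
      with card True show False by simp
    qed
    then obtain i where i: "i < N" "\<not> 0 < a i" by auto
    then have "a i = 0" using nn[of i] by simp
    have "kth_largest {..<N} (\<lambda>i. ennreal (a i)) k = 0"
    proof (rule kth_largest_eqI)
      show "0 \<in> (\<lambda>i. ennreal (a i)) ` {..<N}" using i \<open>a i = 0\<close> by (auto intro!: image_eqI[of _ _ i])
      show "card {i \<in> {..<N}. 0 < ennreal (a i)} < k" using card by (simp only: ennreal_less_zero_iff)
    qed (use True in auto)
    then show ?thesis using True 0 by (simp add: kmax_fin_def)
  qed
qed

lemma kmax_inf_eq_order_stat:
  assumes a: "vanishing a" and nn: "\<And>i. 0 \<le> a i" and k: "1 \<le> k"
  shows "kmax_inf (\<lambda>i. ennreal (a i)) k = ennreal (order_stat a k)"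
proof -
  have L: "limsup (\<lambda>i. ennreal (a i)) = 0"
    using tendsto_ennrealI[OF vanishing_tendsto_0[OF a nn]] by (intro lim_imp_Limsup) auto
  define A where "A = {i. 0 < a i}"
  have eq: "kmax_inf (\<lambda>i. ennreal (a i)) k =
     (if finite A then (if k \<le> card A then kth_largest A (\<lambda>i. ennreal (a i)) k else 0)
      else kth_largest UNIV (\<lambda>i. ennreal (a i)) k)"
    unfolding kmax_inf_def L Let_def ennreal_less_zero_iff A_def ..
  show ?thesis
  proof (cases "finite A")
    case True
    show ?thesis
    proof (cases "k \<le> card A")
      case k': True
      have "0 < order_stat a k"
        by (rule order_stat_pos[OF a k True k']) (simp add: A_def)
      then show ?thesis
        using kth_largest_eq_order_stat[OF a nn k, of A] True k' by (simp add: eq A_def)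
    next
      case k': False
      have "\<not> 0 < order_stat a k"
      proof
        assume y: "0 < order_stat a k"
        then have "k \<le> card {i. order_stat a k / 2 < a i}"
          using less_order_stat_iff[OF a k, of "order_stat a k / 2"] by simp
        also have "\<dots> \<le> card A"
          using y by (intro card_mono True) (auto simp: A_def intro: less_trans[of 0 "order_stat a k / 2"])
        finally show False using k' by simp
      qed
      then have "order_stat a k = 0" using order_stat_nonneg[OF a k] by simp
      then show ?thesis using True k' by (simp add: eq)
    qed
  next
    case False
    then obtain F where F: "finite F" "card F = k" "F \<subseteq> A"
      using infinite_arbitrarily_large by blast
    have "0 < order_stat a k"
      by (rule order_stat_pos[OF a k F(1)]) (use F in \<open>auto simp: A_def\<close>)
    then show ?thesis
      using kth_largest_eq_order_stat[OF a nn k, of UNIV] False by (simp add: eq)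
  qed
qed

section \<open>Listings of p-finite barcodes\<close>

lemma range_bars: "B \<in> countable_barcodes \<Longrightarrow> range (bars B) \<subseteq> Int_bco"
  using enumerates_bars[of B] by (auto simp: enumerates_def)

lemma bars_beyond:
  assumes B: "B \<in> countable_barcodes" and fin: "finite (bar_indices B)" and i: "card (bar_indices B) \<le> i"
  shows "bars B i = {}"
proof (rule ccontr)
  assume ne: "bars B i \<noteq> {}"
  have step: "bars B j = {} \<Longrightarrow> bars B (Suc j) = {}" for j
    using enumerates_bars[OF B] by (auto simp: enumerates_def)
  have "bars B j \<noteq> {}" if "j \<le> i" for j
    using that
  proof (induction rule: inc_induct)
    case base
    show ?case by (rule ne)
  next
    case (step j)
    then show ?case using \<open>\<And>j. bars B j = {} \<Longrightarrow> bars B (Suc j) = {}\<close> by blast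
  qed
  then have "{..i} \<subseteq> bar_indices B" by (auto simp: bar_indices_def)
  from card_mono[OF fin this] i show False by simp
qed

lemma p_finite_barcodesD:
  assumes p: "1 \<le> p" and B: "B \<in> p_finite_barcodes p"
  shows "B \<in> countable_barcodes" "range (bars B) \<subseteq> Int_bco" "p_summable p (bars B)" "vanishing_bars (bars B)"
proof -
  show cb: "B \<in> countable_barcodes" using B by (simp add: p_finite_barcodes_def)
  show I: "range (bars B) \<subseteq> Int_bco" by (rule range_bars[OF cb])
  show "p_summable p (bars B)"
  proof (cases "finite (bar_indices B)")
    case True
    define N where "N = card (bar_indices B)"
    have z: "bars B i = {}" if "i \<ge> N" for i
      using bars_beyond[OF cb True] that by (simp add: N_def)
    show ?thesis
    proof (cases "p = \<infinity>")
      case True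
      have "\<forall>\<^sub>F i in sequentially. 0 = bar_dist \<infinity> (bars B i) {}"
        using z by (intro eventually_sequentiallyI[of N]) simp
      from Lim_transform_eventually[OF tendsto_const this] show ?thesis
        using True by (simp add: p_summable_def)
    next
      case False
      define r where "r = enn2real p"
      have "ennpowr (Lp_norm p (count_space UNIV) (\<lambda>i. bar_dist p (bars B i) {})) r
          = (\<Sum>i<N. ennpowr (bar_dist p (bars B i) {}) r)"
        unfolding r_def ennpowr_Lp_norm[OF p False]
        by (rule nn_integral_count_space') (auto simp: z)
      also have "\<dots> < top"
        using bar_dist_less_top[OF range_subsetD[OF I] p] by (simp add: ennpowr_less_top_iff)
      finally show ?thesis using False by (simp add: p_summable_def ennpowr_less_top_iff)
    qed
  next
    case False
    then show ?thesis using B unfolding p_finite_barcodes_def p_finite_def p_summable_def by blast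
  qed
  then show "vanishing_bars (bars B)" by (rule p_summable_imp_vanishing_bars[OF p I])
qed

lemma landscape_eq_seq_landscape:
  assumes p: "1 \<le> p" and B: "B \<in> p_finite_barcodes p" and x: "x \<in> space landscape_measure"
  shows "landscape B x = seq_landscape (bars B) x"
proof -
  note B = p_finite_barcodesD[OF p B]
  obtain k t where x_eq: "x = (k, t)" by (cases x)
  have k: "1 \<le> k" using x by (simp add: x_eq landscape_measure_def space_pair_measure)
  define a where "a i = triangle (bars B i) t" for i
  have v: "vanishing a" unfolding a_def[abs_def] by (rule vanishing_barsD(2)[OF B(4)])
  have nn: "0 \<le> a i" for i unfolding a_def by (rule triangle_nonneg[OF vanishing_barsD(1)[OF B(4)]])
  have z: "a i = 0" if "finite (bar_indices B)" "i \<ge> card (bar_indices B)" for i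
    using bars_beyond[OF B(1) that] by (simp add: a_def)
  have "landscape B x = enn2real (if finite (bar_indices B) then kmax_fin (card (bar_indices B)) (\<lambda>i. ennreal (a i)) k
     else kmax_inf (\<lambda>i. ennreal (a i)) k)"
    by (simp add: x_eq landscape_def Let_def a_def)
  also have "(if finite (bar_indices B) then kmax_fin (card (bar_indices B)) (\<lambda>i. ennreal (a i)) k
     else kmax_inf (\<lambda>i. ennreal (a i)) k) = ennreal (order_stat a k)"
    using kmax_fin_eq_order_stat[OF nn z k] kmax_inf_eq_order_stat[OF v nn k] by simp
  finally show ?thesis
    using order_stat_nonneg[OF v k] by (simp add: x_eq seq_landscape_def a_def[abs_def])
qed

section \<open>The landscape map\<close>

text \<open>Almost everywhere equality on the product holds on each slice, where continuity makes it an
  equality everywhere; the multiplicities are then determined.\<close>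

lemma barcode_eq_of_landscape_AE_eq:
  assumes p: "1 \<le> p" and B: "B \<in> p_finite_barcodes p" and B': "B' \<in> p_finite_barcodes p"
    and ae: "AE x in landscape_measure. landscape B x = landscape B' x"
  shows "B = B'"
proof
  fix K
  note b = p_finite_barcodesD[OF p B] and b' = p_finite_barcodesD[OF p B']
  interpret pair_sigma_finite "count_space {1::nat..}" "lborel :: real measure"
    by (rule pair_sigma_finite_landscape)
  have "AE x in landscape_measure. seq_landscape (bars B) x = seq_landscape (bars B') x"
    using ae
    by (rule AE_mp) (intro AE_I2 impI, simp add: landscape_eq_seq_landscape[OF p B] landscape_eq_seq_landscape[OF p B'])
  then have "AE k in count_space {1..}. AE t in lborel. seq_landscape (bars B) (k, t) = seq_landscape (bars B') (k, t)"
    unfolding landscape_measure_def by (rule AE_pair)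
  then have eq: "seq_landscape (bars B) (k, t) = seq_landscape (bars B') (k, t)" if "1 \<le> k" for k t
    using that
    by (intro continuous_AE_eq_imp_eq[where f = "\<lambda>t. seq_landscape (bars B) (k, t)"] continuous_seq_landscape b(4) b'(4))
      (auto simp: AE_count_space)
  show "B K = B' K"
  proof (cases "K \<in> Int_hat_bco")
    case True
    then obtain x y where K: "K = {x..<y}" "x < y" by (auto simp: Int_hat_bco_def)
    have mult: "C K = (if finite {i. bars C i = K} then enat (card {i. bars C i = K}) else \<infinity>)"
      if "C \<in> countable_barcodes" for C
      using enumerates_bars[OF that] True by (simp add: enumerates_def)
    from copies_eq_of_landscape_eq[OF b(4) b'(4) eq K(2)] show ?thesis
      unfolding mult[OF b(1)] mult[OF b'(1)] by (simp add: K(1))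
  next
    case False
    have zero: "C K = 0" if "C \<in> countable_barcodes" for C
      using that False by (auto simp: countable_barcodes_def)
    show ?thesis by (simp only: zero[OF b(1)] zero[OF b'(1)])
  qed
qed

lemma Lp_norm_cong:
  assumes f: "f \<in> borel_measurable M" and fg: "\<And>x. x \<in> space M \<Longrightarrow> f x = g x"
  shows "Lp_norm p M f = Lp_norm p M g"
proof -
  have "g \<in> borel_measurable M" using f measurable_cong[of M f g borel] fg by blast
  then have "esssup M f = esssup M g" using f fg by (intro esssup_AE_cong AE_I2)
  moreover have "(\<integral>\<^sup>+ x. ennpowr (f x) r \<partial>M) = (\<integral>\<^sup>+ x. ennpowr (g x) r \<partial>M)" for r
    using fg by (intro nn_integral_cong) simp
  ultimately show ?thesis by (simp add: Lp_norm_def)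
qed

lemma Lp_norm_landscape_diff:
  assumes p: "1 \<le> p" and B: "B \<in> p_finite_barcodes p" and B': "B' \<in> p_finite_barcodes p"
  shows "Lp_norm p landscape_measure (\<lambda>x. ennreal \<bar>landscape B x - landscape B' x\<bar>)
    = Lp_norm p landscape_measure (\<lambda>x. ennreal \<bar>seq_landscape (bars B) x - seq_landscape (bars B') x\<bar>)"
proof (rule Lp_norm_cong[symmetric])
  have [measurable]: "seq_landscape (bars B) \<in> borel_measurable landscape_measure"
    "seq_landscape (bars B') \<in> borel_measurable landscape_measure"
    using p_finite_barcodesD(4)[OF p B] p_finite_barcodesD(4)[OF p B'] by (auto intro: measurable_seq_landscape)
  show "(\<lambda>x. ennreal \<bar>seq_landscape (bars B) x - seq_landscape (bars B') x\<bar>) \<in> borel_measurable landscape_measure"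
    by measurable
qed (simp add: landscape_eq_seq_landscape[OF p B] landscape_eq_seq_landscape[OF p B'])

text \<open>The landscape of the empty barcode is \<open>0\<close>, and the distance to the empty barcode is finite.\<close>

lemma landscape_in_Lp_functions:
  assumes p: "1 \<le> p" and B: "B \<in> p_finite_barcodes p"
  shows "landscape B \<in> Lp_functions p landscape_measure"
proof -
  note b = p_finite_barcodesD[OF p B]
  define Z :: "nat \<Rightarrow> real set" where "Z = (\<lambda>_. {})"
  have Z: "range Z \<subseteq> Int_bco" "p_summable p Z"
  proof -
    show "range Z \<subseteq> Int_bco" by (auto simp: Z_def)
    have "Lp_norm p (count_space (UNIV :: nat set)) (\<lambda>_. 0) = 0" if "p \<noteq> \<infinity>"
      using that by (simp add: Lp_norm_def)
    then show "p_summable p Z" by (simp add: p_summable_def Z_def)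
  qed
  have sm[measurable]: "seq_landscape (bars B) \<in> borel_measurable landscape_measure"
    using b(4) by (rule measurable_seq_landscape)
  have m: "landscape B \<in> borel_measurable landscape_measure"
    using sm landscape_eq_seq_landscape[OF p B] by (subst measurable_cong)
  have Z0: "seq_landscape Z x = 0" if "x \<in> space landscape_measure" for x
    using that order_stat_zero_beyond[of 0 "\<lambda>_. 0" "fst x"]
    by (cases x) (auto simp: seq_landscape_def Z_def landscape_measure_def space_pair_measure)
  obtain L where L: "L < top" "wass p (bars B) Z \<longlonglongrightarrow> L"
    using wass_convergent[OF p b(2) Z(1) b(3) Z(2)] by blast
  have "Lp_norm p landscape_measure (\<lambda>x. ennreal \<bar>landscape B x\<bar>)
     = Lp_norm p landscape_measure (\<lambda>x. ennreal \<bar>seq_landscape (bars B) x - seq_landscape Z x\<bar>)"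
  proof (rule Lp_norm_cong)
    show "(\<lambda>x. ennreal \<bar>landscape B x\<bar>) \<in> borel_measurable landscape_measure" using m by measurable
  qed (simp add: Z0 landscape_eq_seq_landscape[OF p B])
  also have "\<dots> \<le> L" by (rule seq_landscape_dist_le[OF p b(2,3) Z L(2,1)])
  also note L(1)
  finally show ?thesis using m by (simp add: Lp_functions_def)
qed

text \<open>For two finite barcodes the listings are their own paddings, and the finite inequality applies; in
  the other cases the distance is the limit along truncations.\<close>

lemma landscape_1_lipschitz:
  assumes p: "1 \<le> p" and B: "B \<in> p_finite_barcodes p" and B': "B' \<in> p_finite_barcodes p"
  shows "Lp_norm p landscape_measure (\<lambda>x. ennreal \<bar>landscape B x - landscape B' x\<bar>) \<le> wasserstein p B B'"
proof (cases "finite (bar_indices B) \<and> finite (bar_indices B')")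
  case True
  note b = p_finite_barcodesD[OF p B] and b' = p_finite_barcodesD[OF p B']
  have pad: "padded (initial_bars C (card (bar_indices C))) = bars C"
    if "C \<in> countable_barcodes" "finite (bar_indices C)" for C
    using bars_beyond[OF that] by (auto simp: fun_eq_iff padded_def initial_bars_def)
  have "Lp_norm p landscape_measure (\<lambda>x. ennreal \<bar>seq_landscape (padded (initial_bars B (card (bar_indices B)))) x
      - seq_landscape (padded (initial_bars B' (card (bar_indices B')))) x\<bar>) \<le> wasserstein p B B'"
    unfolding wasserstein_def if_P[OF True]
    using b(2) b'(2) by (intro landscape_le_finite_wasserstein p) (auto simp: initial_bars_def)
  then show ?thesis
    using True by (simp add: pad b(1) b'(1) Lp_norm_landscape_diff[OF p B B'])
next
  case False
  note b = p_finite_barcodesD[OF p B] and b' = p_finite_barcodesD[OF p B']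
  obtain L where L: "L < top" "wass p (bars B) (bars B') \<longlonglongrightarrow> L"
    using wass_convergent[OF p b(2) b'(2) b(3) b'(3)] by blast
  have "wasserstein p B B' = L"
    unfolding wasserstein_def if_not_P[OF False]
    using limI[OF L(2)] by (simp add: initial_bars_def[abs_def] initial_def[abs_def])
  then show ?thesis
    using seq_landscape_dist_le[OF p b(2,3) b'(2,3) L(2,1)] by (simp add: Lp_norm_landscape_diff[OF p B B'])
qed

theorem theorem4p5:
  fixes p :: ennreal
  assumes "1 \<le> p"
  shows "(\<forall>B\<in>p_finite_barcodes p. landscape B \<in> Lp_functions p landscape_measure) \<and>
    (\<lambda>B. Lp_class p landscape_measure (landscape B))
      \<in> p_finite_barcodes p \<rightarrow> Lp_space p landscape_measure \<and>
    inj_on (\<lambda>B. Lp_class p landscape_measure (landscape B)) (p_finite_barcodes p) \<and>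
    (\<forall>B\<in>p_finite_barcodes p. \<forall>B'\<in>p_finite_barcodes p.
      Lp_norm p landscape_measure (\<lambda>x. ennreal \<bar>landscape B x - landscape B' x\<bar>)
        \<le> wasserstein p B B')"
proof (intro conjI ballI)
  note mem = landscape_in_Lp_functions[OF assms]
  show "landscape B \<in> Lp_functions p landscape_measure" if "B \<in> p_finite_barcodes p" for B
    by (rule mem[OF that])
  show "(\<lambda>B. Lp_class p landscape_measure (landscape B)) \<in> p_finite_barcodes p \<rightarrow> Lp_space p landscape_measure"
    using mem by (auto simp: Lp_class_def Lp_space_def intro: quotientI)
  show "inj_on (\<lambda>B. Lp_class p landscape_measure (landscape B)) (p_finite_barcodes p)"
  proof (rule inj_onI)
    fix B B' assume B: "B \<in> p_finite_barcodes p" and B': "B' \<in> p_finite_barcodes p"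
      and eq: "Lp_class p landscape_measure (landscape B) = Lp_class p landscape_measure (landscape B')"
    have "landscape B' \<in> Lp_class p landscape_measure (landscape B')"
      using mem[OF B'] by (simp add: Lp_class_def Lp_rel_def)
    then have "AE x in landscape_measure. landscape B x = landscape B' x"
      unfolding eq[symmetric] by (simp add: Lp_class_def Lp_rel_def)
    then show "B = B'" by (rule barcode_eq_of_landscape_AE_eq[OF assms B B'])
  qed
  show "Lp_norm p landscape_measure (\<lambda>x. ennreal \<bar>landscape B x - landscape B' x\<bar>) \<le> wasserstein p B B'"
    if "B \<in> p_finite_barcodes p" "B' \<in> p_finite_barcodes p" for B B'
    by (rule landscape_1_lipschitz[OF assms that])
qed

end
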